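(* Assume hypotheses (J1)–(J3) below, assume moreover that there is $\rho>0$ such that every $J^{(N)}$ extends analytically to the strip $|\operatorname{Im}t|<\rho$ and is bounded there uniformly in $N$, and that $L^{(n_{\mathrm{TS}})}_{\mathrm{TS}}(\omega_f)$ is invertible for all odd $n_{\mathrm{TS}}$ with $\sup_{n_{\mathrm{TS}}}\|(L^{(n_{\mathrm{TS}})}_{\mathrm{TS}})^{-1}\|_2<\infty$. Let $\sigma_\infty=\lim_{N\to\infty}\sigma^{(N)}$ (which exists under (J1)–(J3)). Then there exist constants $C'>0$ and $\alpha'>0$ such that for every odd $n_{\mathrm{TS}}\ge3$, $$|\sigma^{(n_{\mathrm{TS}})}_{\mathrm{TS}}-\sigma_\infty|\le C' e^{-\alpha' n_{\mathrm{TS}}}.$$ Hypotheses (with $C,M,\alpha>0$ independent of $N,k$): (J1) $\|\hat{J}^{(N)}_k\|_2\le Ce^{-\alpha|k|}$ for all $N\in\{1,2,\dots\}\cup\{\infty\}$, $k\in\mathbb{Z}$; (J2) $\|\hat{J}^{(N)}_k-\hat{J}^{(\infty)}_k\|_2\le Ce^{-\alpha N}$ for all $N\ge1$, $|k|\le N$; (J3) $\|(L^{(N)}_{\mathrm{HR}})^{-1}\|_2\le M$ and $\|(A^{(N)}_k)^{-1}\|_2\le M$ for all $N\ge1$, $k\in\mathbb{Z}$.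
   Context: Let $n,m\ge1$, $B\in\mathbb{C}^{n\times m}$, $\omega_0>0$, $T_0=2\pi/\omega_0$, $\omega_f\in\mathbb{R}$, $j$ the imaginary unit. For each $N\in\{1,2,\dots\}\cup\{\infty\}$ let $J^{(N)}:\mathbb{R}\to\mathbb{C}^{n\times n}$ be continuous and $T_0$-periodic with Fourier coefficients $\hat{J}^{(N)}_k=\frac{1}{T_0}\int_0^{T_0}J^{(N)}(t)e^{-jk\omega_0t}dt$. Harmonic resolvent: $L^{(N)}_{\mathrm{HR}}$ is the block matrix indexed by $k,\ell\in\{-N,\dots,N\}$ with blocks $\delta_{k\ell}j(\omega_f+k\omega_0)I_n-\hat{J}^{(N)}_{k-\ell}$; $A^{(N)}_k=j(\omega_f+k\omega_0)I_n-\hat{J}^{(N)}_0$; $B^{(N)}_{\mathrm{HR}}$ has $B$ in the $k=0$ block row and zeros elsewhere; $\sigma^{(N)}$ is the largest singular value of $(L^{(N)}_{\mathrm{HR}})^{-1}B^{(N)}_{\mathrm{HR}}$. Time-spectral resolvent: for odd $n_{\mathrm{TS}}=2N+1$, let $\theta_i=2\pi i/n_{\mathrm{TS}}$, $i=0,\dots,n_{\mathrm{TS}}-1$, and let $D\in\mathbb{R}^{n_{\mathrm{TS}}\times n_{\mathrm{TS}}}$ be the Fourier spectral differentiation matrix, $D_{ik}=\tfrac12(-1)^{i-k}\csc\!\big(\pi(i-k)/n_{\mathrm{TS}}\big)$ for $i\ne k$ and $D_{ii}=0$. Let $J_{\mathrm{block}}=\mathrm{blkdiag}\big(J^{(N)}(\theta_0/\omega_0),\dots,J^{(N)}(\theta_{n_{\mathrm{TS}}-1}/\omega_0)\big)$,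 $J_{\mathrm{TS}}=J_{\mathrm{block}}-\omega_0(D\otimes I_n)$, $L^{(n_{\mathrm{TS}})}_{\mathrm{TS}}(\omega_f)=j\omega_fI-J_{\mathrm{TS}}$, and $B_{\mathrm{TS}}=n_{\mathrm{TS}}^{-1/2}(\mathbf{1}_{n_{\mathrm{TS}}}\otimes B)$ where $\mathbf{1}_{n_{\mathrm{TS}}}$ is the all-ones column vector. $\sigma^{(n_{\mathrm{TS}})}_{\mathrm{TS}}$ is the largest singular value of $(L^{(n_{\mathrm{TS}})}_{\mathrm{TS}})^{-1}B_{\mathrm{TS}}$. $\|\cdot\|_2$ is the induced 2-norm. *)

theory Defs
  imports "HOL-Analysis.Analysis" "Jordan_Normal_Form.Schur_Decomposition"
    "Jordan_Normal_Form.Gauss_Jordan_Elimination"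
begin

text \<open>Complex matrices are Jordan_Normal_Form matrices (dimensions carried as data).
  Block matrices with (2N+1) blocks of size n are laid out so that row index r
  belongs to block r div n (block index k = r div n - N) and block-row r mod n.\<close>

definition vnorm2 :: "complex vec \<Rightarrow> real" where
  "vnorm2 x = sqrt (\<Sum>i<dim_vec x. (cmod (x $ i))^2)"

definition opnorm2 :: "complex mat \<Rightarrow> real" where
  "opnorm2 A = Sup {vnorm2 (A *\<^sub>v x) | x. x \<in> carrier_vec (dim_col A) \<and> vnorm2 x \<le> 1}"

definition mat_inv :: "complex mat \<Rightarrow> complex mat" where
  "mat_inv A = the (mat_inverse A)"

definition sigma_max :: "complex mat \<Rightarrow> real" where
  "sigma_max X = sqrt (Max {Re ev | ev. eigenvalue (mat_adjoint X * X) ev})"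

definition T0 :: "real \<Rightarrow> real" where
  "T0 \<omega>0 = 2 * pi / \<omega>0"

definition fourier_coeff :: "nat \<Rightarrow> real \<Rightarrow> (real \<Rightarrow> complex mat) \<Rightarrow> int \<Rightarrow> complex mat" where
  "fourier_coeff n \<omega>0 Jf k = mat n n (\<lambda>(a,b).
     complex_of_real (1 / T0 \<omega>0) *
     integral {0..T0 \<omega>0} (\<lambda>t. Jf t $$ (a,b) * exp (- \<i> * of_int k * of_real \<omega>0 * of_real t)))"

definition L_HR :: "nat \<Rightarrow> real \<Rightarrow> real \<Rightarrow> (real \<Rightarrow> complex mat) \<Rightarrow> nat \<Rightarrow> complex mat" where
  "L_HR n \<omega>0 \<omega>f Jf N = mat ((2*N+1)*n) ((2*N+1)*n) (\<lambda>(r,c).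
     (let k = int (r div n) - int N; l = int (c div n) - int N; a = r mod n; b = c mod n in
      (if k = l \<and> a = b then \<i> * of_real (\<omega>f + of_int k * \<omega>0) else 0)
       - fourier_coeff n \<omega>0 Jf (k - l) $$ (a,b)))"

definition A_k :: "nat \<Rightarrow> real \<Rightarrow> real \<Rightarrow> (real \<Rightarrow> complex mat) \<Rightarrow> int \<Rightarrow> complex mat" where
  "A_k n \<omega>0 \<omega>f Jf k = (\<i> * of_real (\<omega>f + of_int k * \<omega>0)) \<cdot>\<^sub>m 1\<^sub>m n - fourier_coeff n \<omega>0 Jf 0"

definition B_HR :: "nat \<Rightarrow> nat \<Rightarrow> complex mat \<Rightarrow> nat \<Rightarrow> complex mat" where
  "B_HR n m B N = mat ((2*N+1)*n) m (\<lambda>(r,c). if r div n = N then B $$ (r mod n, c) else 0)"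

definition sigma_HR :: "nat \<Rightarrow> nat \<Rightarrow> complex mat \<Rightarrow> real \<Rightarrow> real \<Rightarrow> (real \<Rightarrow> complex mat) \<Rightarrow> nat \<Rightarrow> real" where
  "sigma_HR n m B \<omega>0 \<omega>f Jf N = sigma_max (mat_inv (L_HR n \<omega>0 \<omega>f Jf N) * B_HR n m B N)"

text \<open>Fourier spectral differentiation matrix of size p.\<close>
definition Dmat :: "nat \<Rightarrow> nat \<Rightarrow> nat \<Rightarrow> real" where
  "Dmat p i k = (if i = k then 0 else
     (1/2) * (-1) ^ nat \<bar>int i - int k\<bar> * (1 / sin (pi * real_of_int (int i - int k) / real p)))"

definition J_TS :: "nat \<Rightarrow> real \<Rightarrow> (real \<Rightarrow> complex mat) \<Rightarrow> nat \<Rightarrow> complex mat" where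
  "J_TS n \<omega>0 Jf p = mat (p*n) (p*n) (\<lambda>(r,c).
     (if r div n = c div n then Jf ((2 * pi * real (r div n) / real p) / \<omega>0) $$ (r mod n, c mod n) else 0)
     - of_real (\<omega>0 * Dmat p (r div n) (c div n)) * (if r mod n = c mod n then 1 else 0))"

definition L_TS :: "nat \<Rightarrow> real \<Rightarrow> real \<Rightarrow> (real \<Rightarrow> complex mat) \<Rightarrow> nat \<Rightarrow> complex mat" where
  "L_TS n \<omega>0 \<omega>f Jf p = (\<i> * of_real \<omega>f) \<cdot>\<^sub>m 1\<^sub>m (p*n) - J_TS n \<omega>0 Jf p"

definition B_TS :: "nat \<Rightarrow> nat \<Rightarrow> complex mat \<Rightarrow> nat \<Rightarrow> complex mat" where
  "B_TS n m B p = mat (p*n) m (\<lambda>(r,c). of_real (1 / sqrt (real p)) * B $$ (r mod n, c))"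

definition sigma_TS :: "nat \<Rightarrow> nat \<Rightarrow> complex mat \<Rightarrow> real \<Rightarrow> real \<Rightarrow> (real \<Rightarrow> complex mat) \<Rightarrow> nat \<Rightarrow> real" where
  "sigma_TS n m B \<omega>0 \<omega>f Jf p = sigma_max (mat_inv (L_TS n \<omega>0 \<omega>f Jf p) * B_TS n m B p)"

end

theory Submission
  imports Defs "Jordan_Normal_Form.Spectral_Radius"
begin

text \<open>The largest singular value is the operator norm, so it suffices to compare, for a fixed forcing vector, the norms of
  the two resolvent solutions. Conjugation with exponential weights shows that the harmonic resolvent solution decays
  exponentially in the harmonic index, uniformly in N. Hence its extension by zero nearly solves the equation of level
  N + 1, which makes the harmonic gains converge geometrically. The trigonometric polynomial with these coefficients,
  sampled at the collocation nodes, has the same norm (discrete Parseval) and nearly solves the time-spectral equation: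
  spectral differentiation is exact on it, and what remains are tails of the Fourier series of the Jacobian.
  The uniform bounds on the inverses turn small residuals into small errors.\<close>

section \<open>The spectral norm and the largest singular value\<close>

unbundle no vec_syntax

text \<open>Truncation discards the couplings that leave the window -N..N, and near its edge they
  are not small: harmonic l loses Jacobian coefficients from distance about N - |l| on. What makes
  the loss harmless is that the solution puts little mass on such l. The decay of the coefficients
  over N - |l| and that of the solution over |l| combine into decay over N, and this is why solution
  decay has to precede both comparisons.

  The limit is obtained from a Cauchy sequence: neighbouring levels are compared, each of them
  finite and stable by (J3). Collocation needs the values of the Jacobian at the nodes, not only its
  coefficients; (J1) makes the Fourier series converge uniformly, and a uniqueness theorem
  identifies its sum. Residuals are bounded componentwise and summed crudely, which produces factors
  of order N^2; half of the exponential rate is spent on them.\<close>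

lemma vnorm2_eq_L2_set: "vnorm2 x = L2_set (\<lambda>i. cmod (x $ i)) {..<dim_vec x}"
  by (simp add: vnorm2_def L2_set_def)

lemma vnorm2_nonneg [simp]: "vnorm2 x \<ge> 0"
  by (simp add: vnorm2_eq_L2_set)

lemma vnorm2_sq: "(vnorm2 x)\<^sup>2 = (\<Sum>i<dim_vec x. (cmod (x $ i))\<^sup>2)"
  by (simp add: vnorm2_def sum_nonneg)

lemma vnorm2_zero [simp]: "vnorm2 (0\<^sub>v k) = 0"
  by (simp add: vnorm2_def)

lemma vnorm2_eq_0_iff: "vnorm2 x = 0 \<longleftrightarrow> x = 0\<^sub>v (dim_vec x)"
  by (auto simp: vnorm2_eq_L2_set L2_set_eq_0_iff vec_eq_iff)

lemma vnorm2_smult: "vnorm2 (c \<cdot>\<^sub>v x) = cmod c * vnorm2 x"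
  by (simp add: vnorm2_eq_L2_set norm_mult L2_set_right_distrib cong: L2_set_cong_simp)

lemma vnorm2_unit_vec: "i < k \<Longrightarrow> vnorm2 (unit_vec k i) = 1"
proof -
  assume i: "i < k"
  have "(\<Sum>j<k. (cmod (unit_vec k i $ j))\<^sup>2) = (\<Sum>j<k. if j = i then 1 else 0)"
    by (intro sum.cong) (use i in auto)
  thus ?thesis using i by (simp add: vnorm2_def)
qed

lemma mult_mat_vec_index_sum:
  "A \<in> carrier_mat r c \<Longrightarrow> x \<in> carrier_vec c \<Longrightarrow> i < r \<Longrightarrow> (A *\<^sub>v x) $ i = (\<Sum>j<c. A $$ (i,j) * x $ j)"
  by (simp add: scalar_prod_def atLeast0LessThan)

text \<open>A supremum of reals is meaningful only for a bounded set, so every upper bound read off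
  from \<open>opnorm2\<close> rests on this. A vector of norm at most 1 has components of modulus at
  most 1, hence the sum of the moduli of all entries is a bound.\<close>

lemma opnorm2_bdd_above:
  assumes A: "A \<in> carrier_mat r c"
  shows "bdd_above {vnorm2 (A *\<^sub>v x) | x. x \<in> carrier_vec (dim_col A) \<and> vnorm2 x \<le> 1}"
proof (rule bdd_aboveI)
  fix y assume "y \<in> {vnorm2 (A *\<^sub>v x) | x. x \<in> carrier_vec (dim_col A) \<and> vnorm2 x \<le> 1}"
  then obtain x where x: "x \<in> carrier_vec c" "vnorm2 x \<le> 1" and y: "y = vnorm2 (A *\<^sub>v x)"
    using A by auto
  have x1: "cmod (x $ j) \<le> 1" if "j < c" for j
    using member_le_L2_set[of "{..<c}" j "\<lambda>i. cmod (x $ i)"] x that by (simp add: vnorm2_eq_L2_set)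
  have "y \<le> (\<Sum>i<r. cmod ((A *\<^sub>v x) $ i))"
    unfolding y vnorm2_eq_L2_set using A x by (intro order_trans[OF L2_set_le_sum_abs]) auto
  also have "\<dots> \<le> (\<Sum>i<r. \<Sum>j<c. cmod (A $$ (i,j)))"
  proof (rule sum_mono)
    fix i assume i: "i \<in> {..<r}"
    have "cmod ((A *\<^sub>v x) $ i) \<le> (\<Sum>j<c. cmod (A $$ (i,j) * x $ j))"
      using mult_mat_vec_index_sum[OF A x(1)] i by (simp add: norm_sum)
    also have "\<dots> \<le> (\<Sum>j<c. cmod (A $$ (i,j)))"
      by (intro sum_mono) (auto simp: norm_mult intro!: mult_left_le x1)
    finally show "cmod ((A *\<^sub>v x) $ i) \<le> (\<Sum>j<c. cmod (A $$ (i,j)))" .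
  qed
  finally show "y \<le> (\<Sum>i<r. \<Sum>j<c. cmod (A $$ (i,j)))" .
qed

lemma vnorm2_le_opnorm2:
  assumes A: "A \<in> carrier_mat r c" and x: "x \<in> carrier_vec c" "vnorm2 x \<le> 1"
  shows "vnorm2 (A *\<^sub>v x) \<le> opnorm2 A"
  unfolding opnorm2_def by (rule cSup_upper[OF _ opnorm2_bdd_above[OF A]]) (use A x in auto)

lemma opnorm2_nonneg: "A \<in> carrier_mat r c \<Longrightarrow> opnorm2 A \<ge> 0"
  using vnorm2_le_opnorm2[of A r c "0\<^sub>v c"] by (force intro: order_trans[OF vnorm2_nonneg])

lemma opnorm2_le:
  assumes "A \<in> carrier_mat r c" "\<And>x. x \<in> carrier_vec c \<Longrightarrow> vnorm2 x \<le> 1 \<Longrightarrow> vnorm2 (A *\<^sub>v x) \<le> K"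
  shows "opnorm2 A \<le> K"
  unfolding opnorm2_def
proof (rule cSup_least)
  have "0\<^sub>v c \<in> carrier_vec (dim_col A) \<and> vnorm2 (0\<^sub>v c :: complex vec) \<le> 1" using assms by simp
  thus "{vnorm2 (A *\<^sub>v x) | x. x \<in> carrier_vec (dim_col A) \<and> vnorm2 x \<le> 1} \<noteq> {}" by blast
qed (use assms in auto)

lemma vnorm2_mult_mat_vec_le:
  assumes A: "A \<in> carrier_mat r c" and x: "x \<in> carrier_vec c"
  shows "vnorm2 (A *\<^sub>v x) \<le> opnorm2 A * vnorm2 x"
proof (cases "vnorm2 x = 0")
  case True
  hence "x = 0\<^sub>v c" using x vnorm2_eq_0_iff[of x] by simp
  moreover have "A *\<^sub>v 0\<^sub>v c = 0\<^sub>v r" using A by (intro eq_vecI) (auto simp: scalar_prod_def)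
  ultimately show ?thesis by simp
next
  case False
  define y where "y = complex_of_real (1 / vnorm2 x) \<cdot>\<^sub>v x"
  have pos: "vnorm2 x > 0" using False vnorm2_nonneg[of x] by linarith
  have y: "y \<in> carrier_vec c" "vnorm2 y = 1" using x pos by (auto simp: y_def vnorm2_smult norm_divide)
  have "vnorm2 (A *\<^sub>v y) \<le> opnorm2 A" by (rule vnorm2_le_opnorm2[OF A y(1)]) (simp add: y)
  moreover have "A *\<^sub>v y = complex_of_real (1 / vnorm2 x) \<cdot>\<^sub>v (A *\<^sub>v x)"
    unfolding y_def using A x by (simp add: mult_mat_vec)
  ultimately have "vnorm2 (A *\<^sub>v x) / vnorm2 x \<le> opnorm2 A" using pos by (simp add: vnorm2_smult norm_divide)
  thus ?thesis using pos by (simp add: field_simps)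
qed

text \<open>An entry is a component of the image of a unit vector. This carries (J1) and (J2) over
  to single entries, the form in which the later estimates use them.\<close>

lemma cmod_index_le_opnorm2:
  assumes A: "A \<in> carrier_mat r c" and ij: "i < r" "j < c"
  shows "cmod (A $$ (i,j)) \<le> opnorm2 A"
proof -
  have "A *\<^sub>v unit_vec c j = col A j" using A ij by (intro eq_vecI) auto
  hence "cmod (A $$ (i,j)) = cmod ((A *\<^sub>v unit_vec c j) $ i)" using A ij by simp
  also have "\<dots> \<le> vnorm2 (A *\<^sub>v unit_vec c j)"
    unfolding vnorm2_eq_L2_set
    by (rule member_le_L2_set[of _ i "\<lambda>i. cmod ((A *\<^sub>v unit_vec c j) $ i)"]) (use A ij in auto)
  also have "\<dots> \<le> opnorm2 A" by (rule vnorm2_le_opnorm2[OF A]) (use ij in \<open>auto simp: vnorm2_unit_vec\<close>)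
  finally show ?thesis .
qed

section \<open>The inner product and the spectrum of X^* X\<close>

definition cip :: "complex vec \<Rightarrow> complex vec \<Rightarrow> complex" where
  "cip x y = (\<Sum>i<dim_vec x. x $ i * cnj (y $ i))"

lemma cip_self: "cip x x = of_real ((vnorm2 x)\<^sup>2)"
  by (simp add: cip_def vnorm2_def sum_nonneg complex_norm_square[symmetric])

lemma vnorm2_add_smult_sq:
  assumes "x \<in> carrier_vec k" "z \<in> carrier_vec k"
  shows "(vnorm2 (x + of_real \<tau> \<cdot>\<^sub>v z))\<^sup>2 = (vnorm2 x)\<^sup>2 + 2 * \<tau> * Re (cip x z) + \<tau>\<^sup>2 * (vnorm2 z)\<^sup>2"
proof -
  have "(cmod (a + of_real \<tau> * b))\<^sup>2 = (cmod a)\<^sup>2 + 2 * \<tau> * Re (a * cnj b) + \<tau>\<^sup>2 * (cmod b)\<^sup>2" for a b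
    unfolding cmod_power2 by (simp add: power2_eq_square algebra_simps)
  hence "(\<Sum>i<k. (cmod ((x + of_real \<tau> \<cdot>\<^sub>v z) $ i))\<^sup>2)
      = (\<Sum>i<k. (cmod (x $ i))\<^sup>2 + 2 * \<tau> * Re (x $ i * cnj (z $ i)) + \<tau>\<^sup>2 * (cmod (z $ i))\<^sup>2)"
    using assms by (intro sum.cong) auto
  also have "\<dots> = (\<Sum>i<k. (cmod (x $ i))\<^sup>2) + 2 * \<tau> * (\<Sum>i<k. Re (x $ i * cnj (z $ i)))
      + \<tau>\<^sup>2 * (\<Sum>i<k. (cmod (z $ i))\<^sup>2)"
    by (simp only: sum.distrib sum_distrib_left)
  finally show ?thesis using assms by (simp add: vnorm2_sq cip_def del: times_complex.sel)
qed

lemma cip_adjoint_mult: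
  assumes X: "X \<in> carrier_mat r m" and x: "x \<in> carrier_vec m" and y: "y \<in> carrier_vec m"
  shows "cip ((mat_adjoint X * X) *\<^sub>v x) y = cip (X *\<^sub>v x) (X *\<^sub>v y)"
proof -
  have adj: "mat_adjoint X \<in> carrier_mat m r" using X unfolding mat_adjoint_def by auto
  have ent: "mat_adjoint X $$ (i,j) = cnj (X $$ (j,i))" if "i < m" "j < r" for i j
    using X that unfolding mat_adjoint_def by (auto simp: mat_of_rows_index)
  have Xx: "X *\<^sub>v x \<in> carrier_vec r" using X x by auto
  have "(mat_adjoint X * X) *\<^sub>v x = mat_adjoint X *\<^sub>v (X *\<^sub>v x)"
    using adj X x by (rule assoc_mult_mat_vec)
  hence "cip ((mat_adjoint X * X) *\<^sub>v x) y = (\<Sum>i<m. (\<Sum>j<r. cnj (X $$ (j,i)) * (X *\<^sub>v x) $ j) * cnj (y $ i))"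
    using adj unfolding cip_def
    by (auto intro!: sum.cong simp: mult_mat_vec_index_sum[OF adj Xx] ent simp del: index_mult_mat_vec)
  also have "\<dots> = (\<Sum>j<r. (X *\<^sub>v x) $ j * (\<Sum>i<m. cnj (X $$ (j,i)) * cnj (y $ i)))"
    unfolding sum_distrib_left sum_distrib_right by (subst sum.swap) (simp add: mult_ac)
  also have "\<dots> = (\<Sum>j<r. (X *\<^sub>v x) $ j * cnj ((X *\<^sub>v y) $ j))"
    by (auto intro!: sum.cong simp: mult_mat_vec_index_sum[OF X y] simp del: index_mult_mat_vec)
  finally show ?thesis using X by (simp add: cip_def)
qed

text \<open>Pairing the eigenvector equation with the eigenvector v itself gives ev |v|^2 = |X v|^2,
  so an eigenvalue is a squared amplification factor.\<close>

lemma Re_eigenvalue_adjoint_mult: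
  assumes X: "X \<in> carrier_mat r m" and ev: "eigenvalue (mat_adjoint X * X) ev"
  shows "Re ev \<le> (opnorm2 X)\<^sup>2"
proof -
  have dim: "dim_row (mat_adjoint X * X) = m" using X unfolding mat_adjoint_def by auto
  obtain v where v: "v \<in> carrier_vec m" "v \<noteq> 0\<^sub>v m" "(mat_adjoint X * X) *\<^sub>v v = ev \<cdot>\<^sub>v v"
    using ev unfolding eigenvalue_def eigenvector_def dim by auto
  have "cip (ev \<cdot>\<^sub>v v) v = ev * cip v v"
    by (simp add: cip_def sum_distrib_left mult_ac)
  hence "ev * of_real ((vnorm2 v)\<^sup>2) = of_real ((vnorm2 (X *\<^sub>v v))\<^sup>2)"
    using cip_adjoint_mult[OF X v(1) v(1)] v(3) by (simp add: cip_self)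
  hence "Re (ev * of_real ((vnorm2 v)\<^sup>2)) = (vnorm2 (X *\<^sub>v v))\<^sup>2" by simp
  hence "Re ev * (vnorm2 v)\<^sup>2 = (vnorm2 (X *\<^sub>v v))\<^sup>2" by simp
  also have "\<dots> \<le> (opnorm2 X * vnorm2 v)\<^sup>2"
    using vnorm2_mult_mat_vec_le[OF X v(1)] by (intro power_mono) auto
  finally have "Re ev * (vnorm2 v)\<^sup>2 \<le> (opnorm2 X)\<^sup>2 * (vnorm2 v)\<^sup>2" by (simp add: power_mult_distrib)
  moreover have "vnorm2 v \<noteq> 0" using v vnorm2_eq_0_iff[of v] by auto
  ultimately show ?thesis by simp
qed

text \<open>Write s for the norm of X and q(x) = s^2 |x|^2 - |X x|^2, a nonnegative quadratic form. Evaluating q at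
  x + \<tau> z with z = (X^* X - s^2) x gives |z|^2 \<le> (s^2 + 1) q(x). If X^* X - s^2 were invertible,
  then q(x) \<ge> \<delta> |x|^2 for some \<delta> > 0, and s would not be the supremum.\<close>

lemma opnorm2_sq_eigenvalue:
  assumes X: "X \<in> carrier_mat r m" and m: "m \<ge> 1"
  shows "eigenvalue (mat_adjoint X * X) (of_real ((opnorm2 X)\<^sup>2))"
proof (rule ccontr)
  define s where "s = opnorm2 X"
  define H where "H = mat_adjoint X * X"
  have H: "H \<in> carrier_mat m m" using X unfolding H_def mat_adjoint_def by auto
  define Z where "Z = char_matrix H (of_real (s\<^sup>2))"
  have Z: "Z \<in> carrier_mat m m" using H by (simp add: Z_def)
  assume "\<not> ?thesis"
  hence "det Z \<noteq> 0" using eigenvalue_det[OF H] by (simp add: s_def H_def Z_def)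
  \<comment> \<open>\<open>undefined\<close> fills the record extension of \<open>ring_mat\<close>;
    all that is taken from the unit property is a left inverse.\<close>
  from det_non_zero_imp_unit[OF Z this, of undefined] obtain R where R: "R \<in> carrier_mat m m" "R * Z = 1\<^sub>m m"
    unfolding Units_def by (auto simp: ring_mat_def)
  have s0: "s \<ge> 0" unfolding s_def by (rule opnorm2_nonneg[OF X])
  define q where "q x = s\<^sup>2 * (vnorm2 x)\<^sup>2 - (vnorm2 (X *\<^sub>v x))\<^sup>2" for x
  have q0: "q x \<ge> 0" if x: "x \<in> carrier_vec m" for x
  proof -
    have "(vnorm2 (X *\<^sub>v x))\<^sup>2 \<le> (s * vnorm2 x)\<^sup>2"
      using vnorm2_mult_mat_vec_le[OF X x] by (intro power_mono) (auto simp: s_def)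
    thus ?thesis by (simp add: q_def power_mult_distrib)
  qed
  have Zq: "(vnorm2 (Z *\<^sub>v x))\<^sup>2 \<le> (s\<^sup>2 + 1) * q x" if x: "x \<in> carrier_vec m" for x
  proof -
    define z where "z = Z *\<^sub>v x"
    \<comment> \<open>Along z the form q falls at rate 2 |z|^2, while its quadratic coefficient q(z)
      is at most (s^2 + 1) |z|^2. This step length balances the two and leaves a net drop of
      \<open>\<tau>\<close> |z|^2; the summand 1 keeps it finite for s = 0.\<close>
    define \<tau> where "\<tau> = 1 / (s\<^sup>2 + 1)"
    have z: "z \<in> carrier_vec m" using Z x by (simp add: z_def)
    have "Z = H - of_real (s\<^sup>2) \<cdot>\<^sub>m 1\<^sub>m m" using H by (auto simp: Z_def char_matrix_def)
    hence zz: "z = H *\<^sub>v x - of_real (s\<^sup>2) \<cdot>\<^sub>v x"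
      unfolding z_def using H x by (auto simp: minus_mult_distrib_mat_vec[of _ m m])
    have "cip z z = cip (H *\<^sub>v x) z - of_real (s\<^sup>2) * cip x z"
      unfolding cip_def using z x H
      by (subst (1) zz) (auto simp: sum_subtractf sum_distrib_left algebra_simps)
    hence cz: "Re (cip (X *\<^sub>v x) (X *\<^sub>v z)) = (vnorm2 z)\<^sup>2 + s\<^sup>2 * Re (cip x z)"
      using cip_adjoint_mult[OF X x z] unfolding H_def[symmetric] cip_self
      by (simp add: complex_eq_iff)
    have Xxz: "X *\<^sub>v (x + of_real \<tau> \<cdot>\<^sub>v z) = X *\<^sub>v x + of_real \<tau> \<cdot>\<^sub>v (X *\<^sub>v z)"
      using X x z by (simp add: mult_add_distrib_mat_vec[of _ r m] mult_mat_vec)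
    have "0 \<le> q (x + of_real \<tau> \<cdot>\<^sub>v z)" by (rule q0) (use x z in auto)
    also have "\<dots> = q x - 2 * \<tau> * (vnorm2 z)\<^sup>2 + \<tau>\<^sup>2 * q z"
      unfolding q_def Xxz using X x z cz
      by (subst vnorm2_add_smult_sq[of _ m] vnorm2_add_smult_sq[of _ r]; (auto simp: algebra_simps)?)+
    also have "\<dots> \<le> q x - 2 * \<tau> * (vnorm2 z)\<^sup>2 + \<tau>\<^sup>2 * ((s\<^sup>2 + 1) * (vnorm2 z)\<^sup>2)"
      by (intro add_left_mono mult_left_mono) (auto simp: q_def algebra_simps add_nonneg_nonneg)
    also have "\<tau>\<^sup>2 * ((s\<^sup>2 + 1) * (vnorm2 z)\<^sup>2) = (\<tau> * (s\<^sup>2 + 1)) * (\<tau> * (vnorm2 z)\<^sup>2)"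
      by (simp add: power2_eq_square)
    also have "\<tau> * (s\<^sup>2 + 1) = 1"
      using add_nonneg_pos[of "s\<^sup>2" 1] by (simp add: \<tau>_def)
    finally have "\<tau> * (vnorm2 z)\<^sup>2 \<le> q x" by simp
    moreover have "s\<^sup>2 + 1 > 0" by (simp add: add_nonneg_pos)
    ultimately show ?thesis by (simp add: \<tau>_def z_def field_simps)
  qed
  \<comment> \<open>The summand 1 makes F positive even if R has norm 0. Then
    \<open>\<delta>\<close> collects the constants in |x| \<le> F |Z x| and |Z x|^2 \<le> (s^2 + 1)
    q(x).\<close>
  define F where "F = opnorm2 R + 1"
  have F: "F > 0" using opnorm2_nonneg[OF R(1)] by (simp add: F_def)
  define \<delta> where "\<delta> = 1 / (F\<^sup>2 * (s\<^sup>2 + 1))"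
  have s1: "s\<^sup>2 + 1 > 0" by (simp add: add_nonneg_pos)
  have \<delta>: "\<delta> > 0" using F s1 by (simp add: \<delta>_def)
  have gap: "(vnorm2 (X *\<^sub>v x))\<^sup>2 \<le> (s\<^sup>2 - \<delta>) * (vnorm2 x)\<^sup>2" if x: "x \<in> carrier_vec m" for x
  proof -
    have Zx: "Z *\<^sub>v x \<in> carrier_vec m" using Z x by simp
    have "x = R *\<^sub>v (Z *\<^sub>v x)" using assoc_mult_mat_vec[OF R(1) Z x] R(2) x by simp
    hence "vnorm2 x \<le> opnorm2 R * vnorm2 (Z *\<^sub>v x)" using vnorm2_mult_mat_vec_le[OF R(1) Zx] by metis
    also have "\<dots> \<le> F * vnorm2 (Z *\<^sub>v x)" by (simp add: F_def mult_right_mono)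
    finally have "(vnorm2 x)\<^sup>2 \<le> (F * vnorm2 (Z *\<^sub>v x))\<^sup>2" by (intro power_mono) auto
    also have "\<dots> \<le> F\<^sup>2 * ((s\<^sup>2 + 1) * q x)"
      unfolding power_mult_distrib using Zq[OF x] by (intro mult_left_mono) auto
    finally have "\<delta> * (vnorm2 x)\<^sup>2 \<le> q x" using F s1
      by (simp only: \<delta>_def times_divide_eq_left mult_1 pos_divide_le_eq zero_less_power mult_pos_pos)
        (simp add: mult_ac)
    thus ?thesis by (simp add: q_def algebra_simps)
  qed
  \<comment> \<open>Here m \<ge> 1 enters: a vector of norm 1 exists, and testing the gap on it
    shows that s^2 - \<open>\<delta>\<close> is nonnegative, so the square root below is
    genuine.\<close>
  have u: "unit_vec m 0 \<in> carrier_vec m" "vnorm2 (unit_vec m 0) = 1" using m by (auto simp: vnorm2_unit_vec)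
  have sd: "s\<^sup>2 - \<delta> \<ge> 0" using order_trans[OF zero_le_power2 gap[OF u(1)]] u(2) by simp
  have "s \<le> sqrt (s\<^sup>2 - \<delta>)"
    unfolding s_def
  proof (rule opnorm2_le[OF X])
    fix x :: "complex vec" assume x: "x \<in> carrier_vec m" "vnorm2 x \<le> 1"
    have "(vnorm2 (X *\<^sub>v x))\<^sup>2 \<le> (s\<^sup>2 - \<delta>) * (vnorm2 x)\<^sup>2" by (rule gap[OF x(1)])
    also have "\<dots> \<le> s\<^sup>2 - \<delta>" using sd x(2) by (intro mult_left_le) (auto simp: power_le_one)
    finally show "vnorm2 (X *\<^sub>v x) \<le> sqrt ((opnorm2 X)\<^sup>2 - \<delta>)" by (simp add: s_def real_le_rsqrt)
  qed
  hence "s\<^sup>2 \<le> s\<^sup>2 - \<delta>" using s0 sd by (metis power_mono real_sqrt_pow2)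
  thus False using \<delta> by simp
qed

text \<open>\<open>Max\<close> needs a finite nonempty set: the spectrum of a matrix is finite, and
  the squared norm is a member that no eigenvalue exceeds in real part.\<close>

lemma sigma_max_eq_opnorm2:
  assumes X: "X \<in> carrier_mat r m" and m: "m \<ge> 1"
  shows "sigma_max X = opnorm2 X"
proof -
  let ?H = "mat_adjoint X * X"
  have H: "?H \<in> carrier_mat m m" using X unfolding mat_adjoint_def by auto
  have "{Re ev | ev. eigenvalue ?H ev} = Re ` spectrum ?H" by (auto simp: spectrum_def)
  hence fin: "finite {Re ev | ev. eigenvalue ?H ev}" using card_finite_spectrum(1)[OF H] by simp
  have "(opnorm2 X)\<^sup>2 \<in> {Re ev | ev. eigenvalue ?H ev}"
    using opnorm2_sq_eigenvalue[OF X m] by (force simp del: of_real_power)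
  hence "Max {Re ev | ev. eigenvalue ?H ev} = (opnorm2 X)\<^sup>2"
    using Re_eigenvalue_adjoint_mult[OF X] by (intro Max_eqI[OF fin]) auto
  thus ?thesis unfolding sigma_max_def using opnorm2_nonneg[OF X] by simp
qed

text \<open>The matrices may have different numbers of rows, so their difference need not make
  sense. What can be compared are the lengths of the images of one and the same input; a bound
  uniform over the unit ball passes to the suprema.\<close>

lemma sigma_max_diff_le:
  assumes X: "X \<in> carrier_mat r m" and Y: "Y \<in> carrier_mat r' m" and m: "m \<ge> 1"
    and close: "\<And>u. u \<in> carrier_vec m \<Longrightarrow> vnorm2 u \<le> 1 \<Longrightarrow> \<bar>vnorm2 (X *\<^sub>v u) - vnorm2 (Y *\<^sub>v u)\<bar> \<le> \<epsilon>"
  shows "\<bar>sigma_max X - sigma_max Y\<bar> \<le> \<epsilon>"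
proof -
  have "opnorm2 X \<le> opnorm2 Y + \<epsilon>"
  proof (rule opnorm2_le[OF X])
    fix u :: "complex vec" assume "u \<in> carrier_vec m" "vnorm2 u \<le> 1"
    thus "vnorm2 (X *\<^sub>v u) \<le> opnorm2 Y + \<epsilon>"
      using close[of u] vnorm2_le_opnorm2[OF Y, of u] by (auto simp: abs_le_iff)
  qed
  moreover have "opnorm2 Y \<le> opnorm2 X + \<epsilon>"
  proof (rule opnorm2_le[OF Y])
    fix u :: "complex vec" assume "u \<in> carrier_vec m" "vnorm2 u \<le> 1"
    thus "vnorm2 (Y *\<^sub>v u) \<le> opnorm2 X + \<epsilon>"
      using close[of u] vnorm2_le_opnorm2[OF X, of u] by (auto simp: abs_le_iff)
  qed
  ultimately show ?thesis
    using sigma_max_eq_opnorm2[OF X m] sigma_max_eq_opnorm2[OF Y m] by simp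
qed

lemma mat_inv_inverse:
  assumes A: "A \<in> carrier_mat k k" and inv: "invertible_mat A"
  shows "mat_inv A \<in> carrier_mat k k" "A * mat_inv A = 1\<^sub>m k" "mat_inv A * A = 1\<^sub>m k"
proof -
  obtain R where "inverts_mat A R" "inverts_mat R A" using inv unfolding invertible_mat_def by auto
  hence R: "A * R = 1\<^sub>m k" "R * A = 1\<^sub>m (dim_row R)" using A by (auto simp: inverts_mat_def)
  have "dim_col R = k" using R(1) by (metis index_mult_mat(3) index_one_mat(3))
  moreover have "dim_row R = k" using R(2) A by (metis carrier_matD(2) index_mult_mat(3) index_one_mat(3))
  ultimately have "A \<in> Units (ring_mat TYPE(complex) k b)" for b :: nat
    using R A unfolding Units_def by (auto simp: ring_mat_def intro!: bexI[of _ R])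
  then obtain S where "mat_inverse A = Some S" using mat_inverse(1)[OF A] by (metis not_None_eq)
  thus "mat_inv A \<in> carrier_mat k k" "A * mat_inv A = 1\<^sub>m k" "mat_inv A * A = 1\<^sub>m k"
    using mat_inverse(2)[OF A] by (auto simp: mat_inv_def)
qed

section \<open>Fourier series of continuous periodic functions\<close>

definition fexp :: "real \<Rightarrow> int \<Rightarrow> real \<Rightarrow> complex" where
  "fexp w k t = exp (\<i> * of_int k * of_real w * of_real t)"

lemma fexp_0 [simp]: "fexp w 0 t = 1"
  by (simp add: fexp_def)

lemma fexp_add: "fexp w (k + l) t = fexp w k t * fexp w l t"
  by (simp add: fexp_def exp_add[symmetric] algebra_simps)

lemma norm_fexp [simp]: "norm (fexp w k t) = 1"
  by (simp add: fexp_def norm_exp_eq_Re)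

lemma continuous_fexp [continuous_intros]: "continuous_on S (fexp w k)"
  unfolding fexp_def by (intro continuous_intros)

lemma fexp_periodic:
  assumes "w > 0"
  shows "fexp w k (t + T0 w) = fexp w k t"
proof -
  have "\<i> * of_int k * of_real w * of_real (t + T0 w)
      = \<i> * of_int k * of_real w * of_real t + of_int (2 * k) * pi * \<i>"
    using assms by (simp add: T0_def algebra_simps)
  thus ?thesis unfolding fexp_def exp_eq by blast
qed

lemma fexp_has_integral:
  assumes w: "w > 0"
  shows "(fexp w k has_integral (if k = 0 then of_real (T0 w) else 0)) {0..T0 w}"
proof (cases "k = 0")
  case True
  have "((\<lambda>_. 1::complex) has_integral (T0 w *\<^sub>R 1)) {0..T0 w}"
    using has_integral_const_real[of "1::complex" 0 "T0 w"] w by (simp add: T0_def)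
  thus ?thesis using True by (simp add: fexp_def[abs_def] scaleR_conv_of_real)
next
  case False
  let ?c = "\<i> * of_int k * complex_of_real w"
  have c: "?c \<noteq> 0" using False w by simp
  have "(fexp w k has_integral (fexp w k (T0 w) / ?c - fexp w k 0 / ?c)) {0..T0 w}"
  proof (rule fundamental_theorem_of_calculus)
    show "0 \<le> T0 w" using w by (simp add: T0_def)
    fix t :: real
    have "((\<lambda>z. exp (?c * z) / ?c) has_field_derivative exp (?c * of_real t)) (at (of_real t))"
      using c by (auto intro!: derivative_eq_intros)
    hence "((\<lambda>t. exp (?c * of_real t) / ?c) has_vector_derivative exp (?c * of_real t)) (at t)"
      by (rule has_vector_derivative_real_field)
    thus "((\<lambda>t. fexp w k t / ?c) has_vector_derivative fexp w k t) (at t within {0..T0 w})"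
      unfolding fexp_def by (rule has_vector_derivative_at_within)
  qed
  moreover have "fexp w k (T0 w) = fexp w k 0" using fexp_periodic[OF w, of k 0] by simp
  ultimately show ?thesis using False by simp
qed

text \<open>Quantifying over all \<psi> orthogonal to the exponentials makes the product case of the induction immediate.\<close>

lemma orthogonal_real_polynomial:
  assumes p: "real_polynomial_function (p :: complex \<Rightarrow> real)"
    and \<psi>: "\<And>k. ((\<lambda>t. \<psi> t * fexp w k t) has_integral 0) S"
  shows "((\<lambda>t. \<psi> t * of_real (p (fexp w 1 t)) * fexp w k t) has_integral 0) S"
  using p \<psi>
proof (induction arbitrary: \<psi> k rule: real_polynomial_function.induct)
  case (linear f)
  interpret bounded_linear f by fact
  \<comment> \<open>A real-linear map of the plane is a combination of z and its conjugate, and on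
    the circle the conjugate of \<open>fexp w 1 t\<close> is \<open>fexp w (-1) t\<close>.
    Multiplying by it only shifts k by one in either direction.\<close>
  let ?a = "(of_real (f 1) - \<i> * of_real (f \<i>)) / 2" and ?b = "(of_real (f 1) + \<i> * of_real (f \<i>)) / 2"
  have f: "complex_of_real (f (fexp w 1 t)) = ?a * fexp w 1 t + ?b * fexp w (-1) t" for t
  proof -
    have conj: "fexp w (-1) t = cnj (fexp w 1 t)" by (simp add: fexp_def exp_cnj)
    define z where "z = fexp w 1 t"
    have "f z = f (Re z *\<^sub>R 1 + Im z *\<^sub>R \<i>)"
      by (rule arg_cong[of _ _ f]) (simp add: complex_eq_iff)
    hence "f (fexp w 1 t) = Re (fexp w 1 t) * f 1 + Im (fexp w 1 t) * f \<i>"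
      by (simp only: add scaleR z_def) simp
    thus ?thesis unfolding conj by (simp add: complex_eq_iff field_simps)
  qed
  have "((\<lambda>t. ?a * (\<psi> t * fexp w (k + 1) t) + ?b * (\<psi> t * fexp w (k - 1) t)) has_integral (?a * 0 + ?b * 0)) S"
    using linear.prems by (intro has_integral_add has_integral_mult_right)
  moreover have "(\<lambda>t. ?a * (\<psi> t * fexp w (k + 1) t) + ?b * (\<psi> t * fexp w (k - 1) t))
      = (\<lambda>t. \<psi> t * of_real (f (fexp w 1 t)) * fexp w k t)"
    unfolding f diff_conv_add_uminus[of k 1] fexp_add by (simp add: algebra_simps)
  ultimately show ?case by simp
next
  case (const c)
  have "((\<lambda>t. of_real c * (\<psi> t * fexp w k t)) has_integral (of_real c * 0)) S"
    using const by (intro has_integral_mult_right)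
  thus ?case by (simp add: mult_ac)
next
  case (add f g)
  from has_integral_add[OF add.IH(1)[OF add.prems] add.IH(2)[OF add.prems]]
  show ?case by (simp add: algebra_simps)
next
  case (mult f g)
  have "((\<lambda>t. \<psi> t * of_real (f (fexp w 1 t)) * of_real (g (fexp w 1 t)) * fexp w k t) has_integral 0) S"
    by (rule mult.IH(2)) (rule mult.IH(1)[OF mult.prems])
  thus ?case by (simp add: mult_ac)
qed

section \<open>Uniqueness of Fourier coefficients and tails of the series\<close>

lemma periodic_of_int:
  assumes "\<And>t::real. \<phi> (t + T) = \<phi> t"
  shows "\<phi> (t + of_int k * T) = \<phi> t"
proof -
  have pos: "\<phi> (s + of_nat j * T) = \<phi> s" for s j
  proof (induction j)
    case (Suc j)
    have "\<phi> (s + of_nat (Suc j) * T) = \<phi> ((s + of_nat j * T) + T)" by (simp add: algebra_simps)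
    thus ?case using Suc assms by simp
  qed simp
  show ?thesis
  proof (cases "k \<ge> 0")
    case True
    thus ?thesis using pos[of t "nat k"] by simp
  next
    case False
    thus ?thesis using pos[of "t + of_int k * T" "nat (-k)"] by (simp add: algebra_simps)
  qed
qed

text \<open>Stone-Weierstrass is applied on the circle, a compact set, so the periodic function has
  to be moved there. \<open>Arg\<close> jumps across the negative real axis; the formula with
  Arg(-z) + pi gives the same value by periodicity and jumps only across the positive axis. The two
  open domains cover every nonzero point.\<close>

lemma continuous_periodic_on_circle:
  fixes \<phi> :: "real \<Rightarrow> complex"
  assumes w: "w > 0" and cont: "continuous_on UNIV \<phi>" and per: "\<And>t. \<phi> (t + T0 w) = \<phi> t"
  obtains \<Phi> where "continuous_on (sphere 0 1) \<Phi>" "\<And>t. \<Phi> (fexp w 1 t) = \<phi> t"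
proof
  define \<Phi> where "\<Phi> z = \<phi> (Arg z / w)" for z
  have same: "\<phi> (a / w) = \<phi> (b / w)" if "exp (\<i> * of_real a) = exp (\<i> * of_real b)" for a b
  proof -
    from that obtain n :: int where "\<i> * of_real a = \<i> * of_real b + (of_int (2 * n) * pi) * \<i>"
      unfolding exp_eq by blast
    hence "\<i> * complex_of_real a = \<i> * complex_of_real (b + of_int n * 2 * pi)"
      by (simp add: algebra_simps)
    hence "a = b + of_int n * 2 * pi" by (metis complex_i_not_zero mult_cancel_left of_real_eq_iff)
    hence "a / w = b / w + of_int n * T0 w" using w by (simp add: T0_def field_simps)
    thus ?thesis using periodic_of_int[of \<phi>, OF per] by simp
  qed
  have cis: "exp (\<i> * of_real (Arg z)) = z / of_real (cmod z)" if "z \<noteq> 0" for z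
    using Arg_eq[OF that, symmetric] that by (simp add: field_simps)
  have neg: "\<Phi> z = \<phi> ((Arg (-z) + pi) / w)" if "z \<noteq> 0" for z
    unfolding \<Phi>_def
  proof (rule same)
    have "exp (\<i> * of_real (Arg (-z) + pi)) = - exp (\<i> * of_real (Arg (-z)))"
      by (simp add: distrib_left exp_add)
    thus "exp (\<i> * of_real (Arg z)) = exp (\<i> * of_real (Arg (-z) + pi))"
      using cis[of z] cis[of "-z"] that by simp
  qed
  have \<phi>o: "continuous_on A (\<lambda>x. \<phi> (g x))" if "continuous_on A g" for A :: "complex set" and g
    by (rule continuous_on_compose2[OF cont that]) auto
  have "continuous_on (- \<real>\<^sub>\<le>\<^sub>0) \<Phi>"
    unfolding \<Phi>_def using w by (intro \<phi>o continuous_intros) auto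
  moreover have "continuous_on (- \<real>\<^sub>\<ge>\<^sub>0) \<Phi>"
  proof -
    have "continuous_on (- \<real>\<^sub>\<ge>\<^sub>0) (\<lambda>z. \<phi> ((Arg (-z) + pi) / w))"
      using w by (intro \<phi>o continuous_intros) (auto simp: complex_nonneg_Reals_iff complex_nonpos_Reals_iff)
    thus ?thesis by (rule continuous_on_eq, subst neg) auto
  qed
  ultimately have "continuous_on (- \<real>\<^sub>\<le>\<^sub>0 \<union> - \<real>\<^sub>\<ge>\<^sub>0) \<Phi>"
    by (intro continuous_on_open_Un) (auto simp: open_Compl)
  thus "continuous_on (sphere 0 1) \<Phi>"
    by (rule continuous_on_subset)
      (auto simp: complex_nonneg_Reals_iff complex_nonpos_Reals_iff cmod_def)
  show "\<Phi> (fexp w 1 t) = \<phi> t" for t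
  proof -
    have "exp (\<i> * of_real (Arg (fexp w 1 t))) = exp (\<i> * of_real (w * t))"
      using cis[of "fexp w 1 t"] norm_fexp[of w 1 t] by (auto simp: fexp_def mult_ac)
    from same[OF this] show ?thesis using w by (simp add: \<Phi>_def)
  qed
qed

text \<open>A polynomial g approximates the conjugate of \<phi> on the circle. As the integral of
  \<phi> g vanishes, the integral of |\<phi>|^2 equals that of \<phi> times the approximation error,
  at most A \<delta> T0 = \<epsilon>. So \<phi> vanishes on one period, hence everywhere.\<close>

lemma fourier_uniqueness:
  fixes \<phi> :: "real \<Rightarrow> complex"
  assumes w: "w > 0" and cont: "continuous_on UNIV \<phi>" and per: "\<And>t. \<phi> (t + T0 w) = \<phi> t"
    and orth: "\<And>k. ((\<lambda>t. \<phi> t * fexp w k t) has_integral 0) {0..T0 w}"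
  shows "\<phi> t = 0"
proof -
  have T: "T0 w > 0" using w by (simp add: T0_def)
  obtain \<Phi> where \<Phi>: "continuous_on (sphere 0 1) \<Phi>" "\<And>t. \<Phi> (fexp w 1 t) = \<phi> t"
    using continuous_periodic_on_circle[OF w cont per] by blast
  have cont': "continuous_on S \<phi>" for S using cont continuous_on_subset by blast
  obtain A where A: "A > 0" "\<And>t. t \<in> {0..T0 w} \<Longrightarrow> cmod (\<phi> t) \<le> A"
    using compact_imp_bounded[OF compact_continuous_image[OF cont'[of "{0..T0 w}"]]]
    by (auto simp: bounded_pos)
  define I where "I = integral {0..T0 w} (\<lambda>t. (cmod (\<phi> t))\<^sup>2)"
  have "I \<le> \<epsilon>" if \<epsilon>: "\<epsilon> > 0" for \<epsilon>
  proof -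
    define \<delta> where "\<delta> = \<epsilon> / (A * T0 w)"
    have \<delta>: "\<delta> > 0" using \<epsilon> A T by (simp add: \<delta>_def)
    obtain g where g: "polynomial_function g" "\<And>z. z \<in> sphere 0 1 \<Longrightarrow> cmod (cnj (\<Phi> z) - g z) < \<delta>"
      using Stone_Weierstrass_polynomial_function[of "sphere 0 1" "\<lambda>z. cnj (\<Phi> z)" \<delta>] \<Phi>(1) \<delta>
      by (auto intro: continuous_intros)
    have ReIm: "real_polynomial_function (Re \<circ> g)" "real_polynomial_function (Im \<circ> g)"
      using g(1) bounded_linear_Re bounded_linear_Im unfolding polynomial_function_def by blast+
    have "((\<lambda>t. \<phi> t * of_real ((Re \<circ> g) (fexp w 1 t)) * fexp w 0 t
        + \<i> * (\<phi> t * of_real ((Im \<circ> g) (fexp w 1 t)) * fexp w 0 t)) has_integral (0 + \<i> * 0)) {0..T0 w}"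
      by (intro has_integral_add has_integral_mult_right orthogonal_real_polynomial ReIm orth)
    moreover have "\<phi> t * of_real ((Re \<circ> g) (fexp w 1 t)) * fexp w 0 t
        + \<i> * (\<phi> t * of_real ((Im \<circ> g) (fexp w 1 t)) * fexp w 0 t) = \<phi> t * g (fexp w 1 t)" for t
      by (simp add: complex_eq_iff algebra_simps)
    ultimately have g0: "((\<lambda>t. \<phi> t * g (fexp w 1 t)) has_integral 0) {0..T0 w}" by simp
    have "((\<lambda>t. (cmod (\<phi> t))\<^sup>2) has_integral I) {0..T0 w}"
      unfolding I_def by (intro integrable_integral integrable_continuous_interval continuous_intros cont')
    hence "((\<lambda>t. complex_of_real ((cmod (\<phi> t))\<^sup>2)) has_integral of_real I) {0..T0 w}"
      by (rule has_integral_of_real)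
    hence "((\<lambda>t. complex_of_real ((cmod (\<phi> t))\<^sup>2) - \<phi> t * g (fexp w 1 t)) has_integral (of_real I - 0)) {0..T0 w}"
      by (intro has_integral_diff g0)
    moreover have "complex_of_real ((cmod (\<phi> t))\<^sup>2) - \<phi> t * g (fexp w 1 t) = \<phi> t * (cnj (\<Phi> (fexp w 1 t)) - g (fexp w 1 t))" for t
      by (simp only: complex_norm_square \<Phi>(2)) (simp add: algebra_simps)
    ultimately have "((\<lambda>t. \<phi> t * (cnj (\<Phi> (fexp w 1 t)) - g (fexp w 1 t))) has_integral of_real I) {0..T0 w}" by simp
    note I = this
    have "cmod (\<phi> t * (cnj (\<Phi> (fexp w 1 t)) - g (fexp w 1 t))) \<le> A * \<delta>" if "t \<in> {0..T0 w}" for t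
      unfolding norm_mult using A \<delta> that by (intro mult_mono) (auto intro!: less_imp_le[OF g(2)])
    hence "norm (complex_of_real I) \<le> A * \<delta> * Henstock_Kurzweil_Integration.content {0..T0 w}"
      using A \<delta> by (intro has_integral_bound_real[OF _ _ I, where S = "{}"]) auto
    also have "\<dots> = \<epsilon>" using A T by (simp add: \<delta>_def)
    finally show ?thesis by simp
  qed
  hence "I \<le> 0" by (meson dense not_le)
  moreover have "I \<ge> 0" unfolding I_def
    by (intro integral_nonneg integrable_continuous_interval continuous_intros cont') auto
  ultimately have "I = 0" by simp
  hence zero: "\<forall>t\<in>{0..T0 w}. (cmod (\<phi> t))\<^sup>2 = 0"
    unfolding I_def by (subst (asm) integral_eq_0_iff) (use T in \<open>auto intro!: continuous_intros cont'\<close>)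
  define k where "k = \<lfloor>t / T0 w\<rfloor>"
  have "t - of_int k * T0 w \<in> {0..T0 w}"
    using T floor_divide_lower[OF T, of t] floor_divide_upper[OF T, of t] by (auto simp: k_def algebra_simps)
  with zero have "\<phi> (t - of_int k * T0 w) = 0" by simp
  thus ?thesis using periodic_of_int[of \<phi> "T0 w" "t - of_int k * T0 w" k] per by simp
qed

text \<open>Negative and nonnegative integers each embed into a geometric series, whence the 2.
  Uniformity in F lets the bound serve shifted index windows as well.\<close>

lemma sum_exp_abs_int_le:
  assumes a: "a > 0" and F: "finite (F :: int set)"
  shows "(\<Sum>k\<in>F. exp (- a * \<bar>real_of_int k\<bar>)) \<le> 2 / (1 - exp (- a))"
proof -
  have q: "exp (- a) < 1" using a by simp
  have half: "(\<Sum>k\<in>G. exp (- a * \<bar>real_of_int k\<bar>)) \<le> 1 / (1 - exp (- a))"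
    if G: "finite G" "inj_on (\<lambda>k. nat \<bar>k\<bar>) G" for G :: "int set"
  proof -
    have "(\<Sum>k\<in>G. exp (- a * \<bar>real_of_int k\<bar>)) = (\<Sum>j\<in>(\<lambda>k. nat \<bar>k\<bar>) ` G. exp (- a) ^ j)"
      unfolding sum.reindex[OF G(2)] by (intro sum.cong) (auto simp: exp_of_nat_mult[symmetric] mult_ac)
    also have "\<dots> \<le> (\<Sum>j. exp (- a) ^ j)"
      using G q by (intro sum_le_suminf summable_geometric) auto
    finally show ?thesis using q by (simp add: suminf_geometric)
  qed
  have "(\<Sum>k\<in>F. exp (- a * \<bar>real_of_int k\<bar>))
      = (\<Sum>k\<in>F \<inter> {0..}. exp (- a * \<bar>real_of_int k\<bar>)) + (\<Sum>k\<in>F - {0..}. exp (- a * \<bar>real_of_int k\<bar>))"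
    using sum.Int_Diff[OF F] by blast
  also have "\<dots> \<le> 1 / (1 - exp (- a)) + 1 / (1 - exp (- a))"
    using F by (intro add_mono half) (auto simp: inj_on_def)
  finally show ?thesis by simp
qed

text \<open>The decay makes the symmetric partial sums converge uniformly to a continuous function
  with the same coefficients, and uniqueness identifies it with f. F need only contain the harmonics
  of modulus below R, because the windows arising later are shifted and hence asymmetric. Half of
  the rate a pays for the factor in R, the other half for the summation.\<close>

lemma fourier_series_tail:
  fixes f :: "real \<Rightarrow> complex" and c :: "int \<Rightarrow> complex"
  assumes w: "w > 0" and cont: "continuous_on UNIV f" and per: "\<And>t. f (t + T0 w) = f t"
    and c: "\<And>k. ((\<lambda>t. f t * fexp w (- k) t) has_integral (of_real (T0 w) * c k)) {0..T0 w}"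
    and a: "a > 0" and C: "\<And>k. cmod (c k) \<le> C * exp (- a * \<bar>real_of_int k\<bar>)"
    and F: "finite F" and R: "\<And>k. k \<notin> F \<Longrightarrow> real R \<le> \<bar>real_of_int k\<bar>"
  shows "cmod (f t - (\<Sum>k\<in>F. c k * fexp w k t)) \<le> 2 * C / (1 - exp (- a / 2)) * exp (- (a / 2) * real R)"
proof -
  have C0: "C \<ge> 0" using order_trans[OF norm_ge_zero C[of 0]] by simp
  define S where "S K t = (\<Sum>k\<in>{-int K..int K}. c k * fexp w k t)" for K t
  \<comment> \<open>For j = 0 the set collapses to {0}, so the constant harmonic is counted
    once.\<close>
  define u where "u j t = (\<Sum>k\<in>{int j, - int j}. c k * fexp w k t)" for j t
  define h where "h t = (\<Sum>j. u j t)" for t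
  have Su: "S K t = (\<Sum>j<Suc K. u j t)" for K t
  proof (induction K)
    case (Suc K)
    have "{-int (Suc K)..int (Suc K)} = {int (Suc K), - int (Suc K)} \<union> {-int K..int K}" by auto
    hence "S (Suc K) t = u (Suc K) t + S K t"
      unfolding S_def u_def by (simp only:) (rule sum.union_disjoint; auto)
    thus ?case using Suc by simp
  qed (simp add: S_def u_def)
  have "cmod (u j t) \<le> 2 * C * exp (- a) ^ j" for j t
  proof -
    have "cmod (u j t) \<le> (\<Sum>k\<in>{int j, - int j}. cmod (c k * fexp w k t))" unfolding u_def by (rule norm_sum)
    also have "\<dots> \<le> (\<Sum>k\<in>{int j, - int j}. C * exp (- a) ^ j)"
    proof (rule sum_mono)
      fix k assume "k \<in> {int j, - int j}"
      hence "\<bar>real_of_int k\<bar> = real j" by auto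
      thus "cmod (c k * fexp w k t) \<le> C * exp (- a) ^ j"
        using C[of k] by (simp add: norm_mult exp_of_nat_mult[symmetric] mult_ac)
    qed
    also have "\<dots> \<le> 2 * (C * exp (- a) ^ j)"
      using C0 by (auto simp: card_insert_if intro!: mult_right_mono)
    finally show ?thesis by simp
  qed
  hence "uniform_limit UNIV (\<lambda>K t. \<Sum>j<K. u j t) h sequentially"
    unfolding h_def using a
    by (intro Weierstrass_m_test[where M = "\<lambda>j. 2 * C * exp (- a) ^ j"] summable_mult summable_geometric) auto
  hence lim: "uniform_limit UNIV S h sequentially"
    unfolding Su[abs_def] by (rule filterlim_compose) (rule filterlim_Suc)
  have conth: "continuous_on UNIV h"
    by (rule uniform_limit_theorem[OF _ lim]) (auto simp: S_def intro!: always_eventually continuous_intros)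
  have orth: "((\<lambda>t. (f t - h t) * fexp w k t) has_integral 0) {0..T0 w}" for k
  proof -
    have "uniform_limit {0..T0 w} (\<lambda>K t. (f t - S K t) * fexp w k t) (\<lambda>t. (f t - h t) * fexp w k t) sequentially"
    proof (rule uniform_limitI)
      fix e :: real assume "e > 0"
      from uniform_limitD[OF lim this]
      show "\<forall>\<^sub>F K in sequentially. \<forall>t\<in>{0..T0 w}. dist ((f t - S K t) * fexp w k t) ((f t - h t) * fexp w k t) < e"
        by eventually_elim (auto simp: dist_norm norm_mult left_diff_distrib[symmetric] norm_minus_commute)
    qed
    then obtain I L where IL: "\<And>K. ((\<lambda>t. (f t - S K t) * fexp w k t) has_integral I K) {0..T0 w}"
      "((\<lambda>t. (f t - h t) * fexp w k t) has_integral L) {0..T0 w}" "I \<longlonglongrightarrow> L"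
      by (rule uniform_limit_integral)
        (auto simp: S_def intro!: continuous_intros continuous_on_subset[OF cont])
    \<comment> \<open>Once K reaches |k|, the partial sum contains the harmonic -k, whose
      contribution cancels that of f; all others integrate to 0 against
      \<open>fexp w k\<close>.\<close>
    have "I K = 0" if K: "K \<ge> nat \<bar>k\<bar>" for K
    proof -
      have "((\<lambda>t. f t * fexp w (- (- k)) t - (\<Sum>l\<in>{-int K..int K}. c l * fexp w (l + k) t)) has_integral
         (of_real (T0 w) * c (- k) - (\<Sum>l\<in>{-int K..int K}. c l * (if l + k = 0 then of_real (T0 w) else 0)))) {0..T0 w}"
        by (intro has_integral_diff has_integral_sum has_integral_mult_right c fexp_has_integral w) auto
      also have "(\<Sum>l\<in>{-int K..int K}. c l * (if l + k = 0 then of_real (T0 w) else 0))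
          = (\<Sum>l\<in>{-int K..int K}. if l = - k then c (- k) * of_real (T0 w) else 0)"
        by (intro sum.cong) auto
      also have "\<dots> = c (- k) * of_real (T0 w)" using K by (subst sum.delta) auto
      also have "(\<lambda>t. f t * fexp w (- (- k)) t - (\<Sum>l\<in>{-int K..int K}. c l * fexp w (l + k) t))
          = (\<lambda>t. (f t - S K t) * fexp w k t)"
        by (simp add: S_def fexp_add left_diff_distrib sum_distrib_right mult.assoc)
      finally show ?thesis using IL(1)[of K] by (simp add: has_integral_unique)
    qed
    hence "I \<longlonglongrightarrow> 0" by (intro tendsto_eventually eventually_sequentiallyI)
    with IL(3) have "L = 0" by (rule LIMSEQ_unique)
    thus ?thesis using IL(2) by simp
  qed
  have perS: "S K (t + T0 w) = S K t" for K t by (simp add: S_def fexp_periodic[OF w])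
  have limp: "(\<lambda>K. S K t) \<longlonglongrightarrow> h t" for t using tendsto_uniform_limitI[OF lim] by simp
  have perh: "h (t + T0 w) = h t" for t
    using limp[of "t + T0 w"] limp[of t] unfolding perS by (rule LIMSEQ_unique)
  have "f t - h t = 0"
    by (rule fourier_uniqueness[OF w _ _ orth]) (auto simp: per perh intro!: continuous_intros cont conth)
  hence fh: "(\<lambda>K. S K t) \<longlonglongrightarrow> f t" using limp by simp
  show ?thesis
  proof (rule LIMSEQ_le_const2)
    show "(\<lambda>K. cmod (S K t - (\<Sum>k\<in>F. c k * fexp w k t))) \<longlonglongrightarrow> cmod (f t - (\<Sum>k\<in>F. c k * fexp w k t))"
      by (intro tendsto_intros fh)
    obtain K0 where K0: "F \<subseteq> {-int K0..int K0}"
    proof -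
      obtain b where "\<And>k. k \<in> F \<Longrightarrow> nat \<bar>k\<bar> \<le> b"
        using finite_imageI[OF F, of "\<lambda>k. nat \<bar>k\<bar>"] by (auto simp: finite_nat_set_iff_bounded_le)
      thus ?thesis by (intro that[of b]) force
    qed
    show "\<exists>N. \<forall>K\<ge>N. cmod (S K t - (\<Sum>k\<in>F. c k * fexp w k t)) \<le> 2 * C / (1 - exp (- a / 2)) * exp (- (a / 2) * real R)"
    proof (intro exI allI impI)
      fix K assume "K0 \<le> K"
      hence FK: "F \<subseteq> {-int K..int K}" using K0 by force
      have "S K t - (\<Sum>k\<in>F. c k * fexp w k t) = (\<Sum>k\<in>{-int K..int K} - F. c k * fexp w k t)"
        unfolding S_def using FK F by (simp add: sum_diff)
      also have "cmod \<dots> \<le> (\<Sum>k\<in>{-int K..int K} - F. cmod (c k * fexp w k t))" by (rule norm_sum)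
      also have "\<dots> \<le> (\<Sum>k\<in>{-int K..int K} - F. C * exp (- (a / 2) * real R) * exp (- (a / 2) * \<bar>real_of_int k\<bar>))"
      proof (rule sum_mono)
        fix k assume k: "k \<in> {-int K..int K} - F"
        have "cmod (c k * fexp w k t) \<le> C * exp (- a * \<bar>real_of_int k\<bar>)" using C by (simp add: norm_mult)
        also have "\<dots> \<le> C * (exp (- (a / 2) * real R) * exp (- (a / 2) * \<bar>real_of_int k\<bar>))"
        proof (rule mult_left_mono[OF _ C0])
          have "a / 2 * real R \<le> a / 2 * \<bar>real_of_int k\<bar>" using R[of k] k a by (intro mult_left_mono) auto
          thus "exp (- a * \<bar>real_of_int k\<bar>) \<le> exp (- (a / 2) * real R) * exp (- (a / 2) * \<bar>real_of_int k\<bar>)"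
            unfolding exp_add[symmetric] by (simp add: field_simps)
        qed
        finally show "cmod (c k * fexp w k t) \<le> C * exp (- (a / 2) * real R) * exp (- (a / 2) * \<bar>real_of_int k\<bar>)"
          by (simp add: mult_ac)
      qed
      also have "\<dots> \<le> C * exp (- (a / 2) * real R) * (2 / (1 - exp (- (a / 2))))"
        unfolding sum_distrib_left[symmetric] using C0 a
        by (intro mult_left_mono sum_exp_abs_int_le) auto
      finally show "cmod (S K t - (\<Sum>k\<in>F. c k * fexp w k t)) \<le> 2 * C / (1 - exp (- a / 2)) * exp (- (a / 2) * real R)"
        by (simp add: mult_ac)
    qed
  qed
qed

section \<open>Spectral differentiation and discrete orthogonality\<close>

definition ts_node :: "real \<Rightarrow> nat \<Rightarrow> nat \<Rightarrow> real" where
  "ts_node w p i = (2 * pi * real i / real p) / w"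

lemma fexp_ts_node:
  assumes "w > 0"
  shows "fexp w k (ts_node w p i) = cis (of_int k * (2 * pi * real i / real p))"
  using assms by (simp add: fexp_def ts_node_def cis_conv_exp mult_ac)

lemma cis_root_eq_1:
  assumes p: "p > 0" and k: "\<bar>k\<bar> < int p" and eq: "cis (2 * pi * of_int k / real p) = 1"
  shows "k = 0"
proof -
  from eq obtain n :: int where n: "2 * pi * of_int k / real p = of_int (2 * n) * pi"
    unfolding cis_conv_exp exp_eq_1 by auto
  hence "real_of_int k = of_int (n * int p)" using p by (simp add: field_simps)
  hence "k = n * int p" by linarith
  hence "int p dvd k" by simp
  thus ?thesis using k dvd_imp_le_int[of k "int p"] by force
qed

text \<open>A geometric sum over a p-th root of unity. The bound on k excludes aliasing: the root
  differs from 1 unless k = 0.\<close>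

lemma sum_fexp_ts_node:
  assumes w: "w > 0" and p: "p > 0" and k: "\<bar>k\<bar> < int p"
  shows "(\<Sum>i<p. fexp w k (ts_node w p i)) = (if k = 0 then of_nat p else 0)"
proof (cases "k = 0")
  case False
  define z where "z = cis (2 * pi * of_int k / real p)"
  have "fexp w k (ts_node w p i) = z ^ i" for i
    unfolding fexp_ts_node[OF w] z_def Complex.DeMoivre by (simp add: mult_ac)
  moreover have "z \<noteq> 1" using cis_root_eq_1[OF p k] False by (auto simp: z_def)
  moreover have "z ^ p = 1" using p cis_multiple_2pi[of "of_int k"] by (simp add: z_def Complex.DeMoivre)
  ultimately show ?thesis using False by (simp add: geometric_sum)
qed simp

text \<open>The square expands into frequency differences of modulus at most 2N, one less than the
  number of nodes, so only the diagonal terms survive.\<close>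

lemma ts_parseval:
  fixes x :: "int \<Rightarrow> complex"
  assumes w: "w > 0" and p: "p = 2 * N + 1"
  shows "(\<Sum>i<p. (cmod (\<Sum>k=-int N..int N. x k * fexp w k (ts_node w p i)))\<^sup>2)
    = real p * (\<Sum>k=-int N..int N. (cmod (x k))\<^sup>2)"
proof -
  let ?I = "{-int N..int N}" and ?e = "\<lambda>k i. fexp w k (ts_node w p i)"
  have cnj: "cnj (?e k i) = ?e (-k) i" for k i by (simp add: fexp_def exp_cnj)
  have "complex_of_real (\<Sum>i<p. (cmod (\<Sum>k\<in>?I. x k * ?e k i))\<^sup>2)
      = (\<Sum>i<p. (\<Sum>k\<in>?I. x k * ?e k i) * (\<Sum>l\<in>?I. cnj (x l) * ?e (-l) i))"
    by (simp only: of_real_sum complex_norm_square cnj_sum complex_cnj_mult cnj)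
  also have "\<dots> = (\<Sum>i<p. \<Sum>k\<in>?I. \<Sum>l\<in>?I. x k * cnj (x l) * ?e (k - l) i)"
    by (simp only: sum_product diff_conv_add_uminus fexp_add) (simp add: mult_ac)
  also have "\<dots> = (\<Sum>k\<in>?I. \<Sum>i<p. \<Sum>l\<in>?I. x k * cnj (x l) * ?e (k - l) i)"
    by (rule sum.swap)
  also have "\<dots> = (\<Sum>k\<in>?I. \<Sum>l\<in>?I. \<Sum>i<p. x k * cnj (x l) * ?e (k - l) i)"
    by (intro sum.cong refl sum.swap)
  also have "\<dots> = (\<Sum>k\<in>?I. \<Sum>l\<in>?I. if l = k then of_nat p * (x k * cnj (x k)) else 0)"
    unfolding sum_distrib_left[symmetric]
    by (intro sum.cong refl, subst sum_fexp_ts_node[OF w]) (auto simp: p)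
  also have "\<dots> = (\<Sum>k\<in>?I. of_nat p * (x k * cnj (x k)))"
    by (intro sum.cong) auto
  also have "\<dots> = complex_of_real (real p * (\<Sum>k\<in>?I. (cmod (x k))\<^sup>2))"
    by (simp only: of_real_mult of_real_sum complex_norm_square sum_distrib_left of_real_of_nat_eq)
  finally show ?thesis by (simp only: of_real_eq_iff)
qed

text \<open>The differentiated geometric sum, cleared of denominators. When z^n = 1 and the powers
  of z sum to 0, the right side reduces to n.\<close>

lemma sum_of_nat_mult_power:
  fixes z :: "'a :: comm_ring_1"
  shows "(z - 1) * (\<Sum>r<n. of_nat r * z ^ r) = of_nat n * z ^ n - z * (\<Sum>r<n. z ^ r)"
  by (induction n) (simp_all add: algebra_simps)

text \<open>Differentiating the Dirichlet kernel at the nodes gives the cosecant entries.\<close>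

lemma Dmat_eq_sum:
  assumes w: "w > 0" and p: "p = 2 * N + 1" and i: "i < p" and k: "k < p"
  shows "complex_of_real (Dmat p i k)
    = (\<Sum>l=-int N..int N. \<i> * of_int l * fexp w l (ts_node w p i) * fexp w (-l) (ts_node w p k)) / of_nat p"
proof (cases "i = k")
  case True
  have "(\<Sum>l=-int N..int N. \<i> * of_int l * fexp w l (ts_node w p i) * fexp w (-l) (ts_node w p i))
      = (\<Sum>l=-int N..int N. \<i> * of_int l * fexp w (l + -l) (ts_node w p i))"
    by (simp only: fexp_add mult.assoc)
  also have "\<dots> = \<i> * of_int (\<Sum>l=-int N..int N. l)"
    by (simp add: sum_distrib_left)
  also have "(\<Sum>l=-int N..int N. l) = 0"
    using sum.reindex_bij_witness[of "{-int N..int N}" uminus uminus "{-int N..int N}" "\<lambda>l. -l" "\<lambda>l. l"]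
    by (simp add: sum_negf)
  finally show ?thesis using True by (simp add: Dmat_def)
next
  case False
  define j where "j = int i - int k"
  define \<phi> where "\<phi> = 2 * pi * of_int j / real p"
  define z where "z = cis \<phi>"
  have p0: "p > 0" using p by simp
  have j: "\<bar>j\<bar> < int p" "j \<noteq> 0" using i k False by (auto simp: j_def)
  have z1: "z \<noteq> 1" using cis_root_eq_1[OF p0 j(1)] j(2) by (auto simp: z_def \<phi>_def)
  have zp: "z ^ p = 1" using p0 cis_multiple_2pi[of "of_int j"] by (simp add: z_def \<phi>_def Complex.DeMoivre)
  have z0: "(\<Sum>r<p. z ^ r) = 0" using z1 zp by (simp add: geometric_sum)
  have "fexp w l (ts_node w p i) * fexp w (-l) (ts_node w p k) = cis (of_int l * \<phi>)" for l
    unfolding fexp_ts_node[OF w] cis_mult using p0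
    by (intro arg_cong[of _ _ cis]) (simp add: \<phi>_def j_def field_simps)
  hence "(\<Sum>l=-int N..int N. \<i> * of_int l * fexp w l (ts_node w p i) * fexp w (-l) (ts_node w p k))
      = (\<Sum>l=-int N..int N. \<i> * of_int l * cis (of_int l * \<phi>))"
    by (simp only: mult.assoc)
  \<comment> \<open>Shifting l by N makes the exponents nonnegative at the price of a phase; the
    part with factor N then vanishes because the powers of z sum to 0.\<close>
  also have "\<dots> = (\<Sum>r<p. \<i> * (of_nat r - of_nat N) * (cis (- real N * \<phi>) * z ^ r))"
  proof (rule sum.reindex_bij_witness[of _ "\<lambda>r. int r - int N" "\<lambda>l. nat (l + int N)"])
    fix l assume "l \<in> {-int N..int N}"
    then obtain r where l: "l = int r - int N" by (metis add.commute add_diff_cancel_left' atLeastAtMost_iff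
          diff_ge_0_iff_ge diff_minus_eq_add nat_0_le)
    have "cis (of_int l * \<phi>) = cis (- real N * \<phi>) * z ^ r"
      unfolding z_def Complex.DeMoivre cis_mult l by (simp add: algebra_simps)
    thus "\<i> * (of_nat (nat (l + int N)) - of_nat N) * (cis (- real N * \<phi>) * z ^ nat (l + int N)) = \<i> * of_int l * cis (of_int l * \<phi>)"
      by (simp add: l)
  qed (auto simp: p)
  also have "\<dots> = \<i> * cis (- real N * \<phi>) * ((\<Sum>r<p. of_nat r * z ^ r) - of_nat N * (\<Sum>r<p. z ^ r))"
    by (simp add: sum_distrib_left sum_subtractf[symmetric] algebra_simps)
  also have "\<dots> = \<i> * cis (- real N * \<phi>) * (\<Sum>r<p. of_nat r * z ^ r)"
    by (simp add: z0)
  also have "(\<Sum>r<p. of_nat r * z ^ r) = of_nat p / (z - 1)"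
    using sum_of_nat_mult_power[of z p] z0 zp z1 by (simp add: field_simps)
  \<comment> \<open>With p = 2N + 1, the angle N \<phi> equals pi j - \<phi>/2. The multiple of pi
    yields the alternating sign of the matrix; the half angle cancels against the one in z - 1 and
    leaves the real cosecant.\<close>
  also have "cis (- real N * \<phi>) = (-1) ^ nat \<bar>j\<bar> * cis (\<phi> / 2)"
  proof -
    have "- real N * \<phi> = - (of_int j * pi) + \<phi> / 2"
      using p by (simp add: \<phi>_def field_simps)
    hence "cis (- real N * \<phi>) = cis (- (of_int j * pi)) * cis (\<phi> / 2)" by (simp only: cis_mult)
    moreover have "cis (- (of_int j * pi)) = (-1) ^ nat \<bar>j\<bar>"
    proof (cases "j \<ge> 0")
      case True
      have "cis (- (of_int j * pi)) = cis (- pi) ^ nat \<bar>j\<bar>" using True by (simp add: Complex.DeMoivre)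
      thus ?thesis by (simp add: complex_eq_iff cis.code)
    next
      case False
      have "cis (- (of_int j * pi)) = cis pi ^ nat \<bar>j\<bar>" using False by (simp only: Complex.DeMoivre) simp
      thus ?thesis by simp
    qed
    ultimately show ?thesis by simp
  qed
  also have zs: "z - 1 = cis (\<phi> / 2) * (2 * \<i> * of_real (sin (\<phi> / 2)))"
  proof -
    have "z - 1 = cis (\<phi> / 2) * (cis (\<phi> / 2) - cis (- (\<phi> / 2)))"
      by (simp add: right_diff_distrib cis_mult z_def)
    thus ?thesis by (simp add: complex_eq_iff)
  qed
  finally have "(\<Sum>l=-int N..int N. \<i> * of_int l * fexp w l (ts_node w p i) * fexp w (-l) (ts_node w p k))
      = of_nat p * ((-1) ^ nat \<bar>j\<bar> / (2 * of_real (sin (\<phi> / 2))))"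
    by simp
  moreover have "complex_of_real (Dmat p i k) = (-1) ^ nat \<bar>j\<bar> / (2 * of_real (sin (\<phi> / 2)))"
    using False by (simp add: Dmat_def j_def \<phi>_def)
  ultimately show ?thesis using p0 by simp
qed

text \<open>By the preceding formula the matrix is a discrete Fourier transform, multiplication by i
  l, and the inverse transform, so orthogonality picks out one harmonic. The derivative is taken in
  the angle; the factor w is supplied outside, in \<open>ts_op\<close>.\<close>

lemma Dmat_fexp:
  assumes w: "w > 0" and p: "p = 2 * N + 1" and i: "i < p" and l: "\<bar>l\<bar> \<le> int N"
  shows "(\<Sum>k<p. of_real (Dmat p i k) * fexp w l (ts_node w p k)) = \<i> * of_int l * fexp w l (ts_node w p i)"
proof -
  let ?I = "{-int N..int N}" and ?e = "\<lambda>k i. fexp w k (ts_node w p i)"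
  have "(\<Sum>k<p. of_real (Dmat p i k) * ?e l k) = (\<Sum>k<p. \<Sum>m\<in>?I. \<i> * of_int m * ?e m i / of_nat p * ?e (l - m) k)"
    by (intro sum.cong refl)
      (simp add: Dmat_eq_sum[OF w p i] sum_distrib_left sum_divide_distrib diff_conv_add_uminus fexp_add mult_ac
        del: add_uminus_conv_diff)
  also have "\<dots> = (\<Sum>m\<in>?I. \<i> * of_int m * ?e m i / of_nat p * (\<Sum>k<p. ?e (l - m) k))"
    by (subst sum.swap) (simp add: sum_distrib_left)
  also have "\<dots> = (\<Sum>m\<in>?I. if m = l then \<i> * of_int l * ?e l i else 0)"
  proof (intro sum.cong refl)
    fix m assume "m \<in> ?I"
    hence "\<bar>l - m\<bar> < int p" using l by (auto simp: p)
    from sum_fexp_ts_node[OF w _ this]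
    show "\<i> * of_int m * ?e m i / of_nat p * (\<Sum>k<p. ?e (l - m) k) = (if m = l then \<i> * of_int l * ?e l i else 0)"
      using i by auto
  qed
  also have "\<dots> = \<i> * of_int l * ?e l i" using l by (subst sum.delta) auto
  finally show ?thesis .
qed

section \<open>Decay of harmonic solutions and residual estimates\<close>

text \<open>Writing K as a product of square roots, Cauchy-Schwarz extracts a row sum; after
  exchanging the summations the column sums bound the rest. Each costs S, and the final square root
  leaves one S.\<close>

lemma L2_set_Schur_test:
  fixes K :: "'a \<Rightarrow> 'a \<Rightarrow> real"
  assumes fin: "finite I" and K0: "\<And>q r. q \<in> I \<Longrightarrow> r \<in> I \<Longrightarrow> K q r \<ge> 0"
    and row: "\<And>q. q \<in> I \<Longrightarrow> (\<Sum>r\<in>I. K q r) \<le> S" and col: "\<And>r. r \<in> I \<Longrightarrow> (\<Sum>q\<in>I. K q r) \<le> S"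
    and S: "S \<ge> 0"
  shows "L2_set (\<lambda>q. \<Sum>r\<in>I. K q r * y r) I \<le> S * L2_set y I"
proof -
  have "(\<Sum>q\<in>I. (\<Sum>r\<in>I. K q r * y r)\<^sup>2) \<le> (\<Sum>q\<in>I. S * (\<Sum>r\<in>I. K q r * (y r)\<^sup>2))"
  proof (rule sum_mono)
    fix q assume q: "q \<in> I"
    have "(\<Sum>r\<in>I. K q r * y r) = (\<Sum>r\<in>I. sqrt (K q r) * (sqrt (K q r) * y r))"
      using K0 q by (intro sum.cong) (auto simp: mult.assoc[symmetric])
    hence "(\<Sum>r\<in>I. K q r * y r)\<^sup>2 \<le> (\<Sum>r\<in>I. (sqrt (K q r))\<^sup>2) * (\<Sum>r\<in>I. (sqrt (K q r) * y r)\<^sup>2)"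
      using Cauchy_Schwarz_ineq_sum[of "\<lambda>r. sqrt (K q r)" "\<lambda>r. sqrt (K q r) * y r" I] by simp
    also have "\<dots> = (\<Sum>r\<in>I. K q r) * (\<Sum>r\<in>I. K q r * (y r)\<^sup>2)"
      using K0 q by (simp add: power_mult_distrib)
    also have "\<dots> \<le> S * (\<Sum>r\<in>I. K q r * (y r)\<^sup>2)"
      using row[OF q] K0 q by (intro mult_right_mono sum_nonneg) auto
    finally show "(\<Sum>r\<in>I. K q r * y r)\<^sup>2 \<le> S * (\<Sum>r\<in>I. K q r * (y r)\<^sup>2)" .
  qed
  also have "\<dots> = S * (\<Sum>r\<in>I. (\<Sum>q\<in>I. K q r) * (y r)\<^sup>2)"
    unfolding sum_distrib_left[symmetric] by (subst sum.swap) (simp add: sum_distrib_right)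
  also have "\<dots> \<le> S * (\<Sum>r\<in>I. S * (y r)\<^sup>2)"
    using col S by (intro mult_left_mono sum_mono mult_right_mono) auto
  finally have "(\<Sum>q\<in>I. (\<Sum>r\<in>I. K q r * y r)\<^sup>2) \<le> S\<^sup>2 * (\<Sum>r\<in>I. (y r)\<^sup>2)"
    by (simp add: sum_distrib_left[symmetric] power2_eq_square mult.assoc)
  hence "sqrt (\<Sum>q\<in>I. (\<Sum>r\<in>I. K q r * y r)\<^sup>2) \<le> sqrt (S\<^sup>2 * (\<Sum>r\<in>I. (y r)\<^sup>2))" by simp
  thus ?thesis using S by (simp add: L2_set_def real_sqrt_mult)
qed

text \<open>Crude, with the cardinality in place of its square root; the exponential rate absorbs
  the polynomial loss in the end.\<close>

lemma L2_set_le_card_mult: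
  assumes "finite I" "\<And>q. q \<in> I \<Longrightarrow> \<bar>f q\<bar> \<le> E"
  shows "L2_set f I \<le> real (card I) * E"
  using L2_set_le_sum_abs[of f I] sum_bounded_above[of I "\<lambda>q. \<bar>f q\<bar>" E] assms(2) by simp

lemma L2_set_cmod_diff_le:
  "\<bar>L2_set (\<lambda>q. cmod (x q)) I - L2_set (\<lambda>q. cmod (y q)) I\<bar> \<le> L2_set (\<lambda>q. cmod (x q - y q)) I"
proof -
  have le: "L2_set (\<lambda>q. cmod (x q)) I \<le> L2_set (\<lambda>q. cmod (y q)) I + L2_set (\<lambda>q. cmod (x q - y q)) I" for x y
  proof -
    have "L2_set (\<lambda>q. cmod (x q)) I \<le> L2_set (\<lambda>q. cmod (y q) + cmod (x q - y q)) I"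
      by (rule L2_set_mono) (auto simp: norm_triangle_sub)
    thus ?thesis by (rule order_trans[OF _ L2_set_triangle_ineq])
  qed
  show ?thesis using le[of x y] le[of y x] by (simp add: norm_minus_commute)
qed

section \<open>Harmonic equations and exponential weights\<close>

definition hr_index :: "nat \<Rightarrow> nat \<Rightarrow> (int \<times> nat) set" where
  "hr_index n N = {-int N..int N} \<times> {..<n}"

text \<open>Block vectors are functions of a pair (harmonic k, component a); c d a b is the (a,b) entry of the
  d-th Fourier coefficient.\<close>

definition hr_op :: "nat \<Rightarrow> real \<Rightarrow> real \<Rightarrow> (int \<Rightarrow> nat \<Rightarrow> nat \<Rightarrow> complex) \<Rightarrow> nat
    \<Rightarrow> (int \<times> nat \<Rightarrow> complex) \<Rightarrow> int \<times> nat \<Rightarrow> complex" where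
  "hr_op n w \<omega>f c N x q = \<i> * of_real (\<omega>f + of_int (fst q) * w) * x q
     - (\<Sum>r\<in>hr_index n N. c (fst q - fst r) (snd q) (snd r) * x r)"

definition hr_rhs :: "(nat \<Rightarrow> complex) \<Rightarrow> int \<times> nat \<Rightarrow> complex" where
  "hr_rhs b q = (if fst q = 0 then b (snd q) else 0)"

lemma finite_hr_index [simp]: "finite (hr_index n N)"
  by (simp add: hr_index_def)

lemma card_hr_index: "card (hr_index n N) = (2 * N + 1) * n"
  by (simp add: hr_index_def card_cartesian_product nat_add_distrib nat_mult_distrib)

text \<open>The factor b/a is the point: it tends to 0 with b, so a mild weight perturbs the
  operator little. It stems from exp(bm) - 1 \<le> b m exp(bm); then m is at most (4/a) exp(am/4),
  and b \<le> a/4 lets half of the decay survive.\<close>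

lemma exp_minus_one_mult_le:
  assumes a: "a > 0" and b: "0 \<le> b" "b \<le> a / 4" and m: "m \<ge> (0::real)"
  shows "(exp (b * m) - 1) * exp (- a * m) \<le> 4 * b / a * exp (- (a / 2) * m)"
proof -
  have "1 - b * m \<le> exp (- (b * m))" using exp_ge_add_one_self[of "- (b * m)"] by simp
  hence "(1 - b * m) * exp (b * m) \<le> 1"
    using mult_right_mono[of "1 - b * m" "exp (- (b * m))" "exp (b * m)"] by (simp add: exp_add[symmetric])
  hence 1: "exp (b * m) - 1 \<le> b * m * exp (b * m)" by (simp add: algebra_simps)
  have "a * m / 4 \<le> exp (a * m / 4)" using exp_ge_add_one_self[of "a * m / 4"] by linarith
  hence 2: "m \<le> 4 / a * exp (a * m / 4)" using a by (simp add: field_simps)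
  have "b * m \<le> a / 4 * m" using b m by (intro mult_right_mono)
  hence 3: "exp (b * m) \<le> exp (a * m / 4)" by simp
  have "b * m * exp (b * m) \<le> b * (4 / a * exp (a * m / 4)) * exp (a * m / 4)"
    using 2 3 a b m by (intro mult_mono) auto
  moreover have "exp (a * m / 2) = exp (a * m / 4) * exp (a * m / 4)" by (simp add: exp_add[symmetric])
  ultimately have "exp (b * m) - 1 \<le> 4 * b / a * exp (a * m / 2)"
    using 1 by (simp add: mult_ac)
  hence "(exp (b * m) - 1) * exp (- a * m) \<le> 4 * b / a * exp (a * m / 2) * exp (- a * m)"
    by (intro mult_right_mono) auto
  also have "\<dots> = 4 * b / a * exp (- (a / 2) * m)"
    by (simp add: mult.assoc exp_add[symmetric])
  finally show ?thesis .
qed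

lemma abs_exp_minus_one_le: "\<bar>exp s - 1\<bar> \<le> exp \<bar>s\<bar> - (1::real)"
proof (cases "s \<ge> 0")
  case False
  have "exp s * exp (-s) = 1" by (simp add: exp_add[symmetric])
  moreover have "(exp s - 1)\<^sup>2 \<ge> 0" by simp
  ultimately have "2 * exp s \<le> exp s * (exp s + exp (-s))" by (simp add: power2_eq_square algebra_simps)
  hence "2 \<le> exp s + exp (-s)" by (simp add: mult.commute)
  thus ?thesis using False by simp
qed simp

text \<open>Conjugating the operator by the weight exp (b |k|) perturbs it by at most 1/(2M) in norm (Schur test), so the
  weighted solution still obeys the stability estimate, while the right-hand side, supported at k = 0, is unchanged.\<close>

lemma hr_solution_decay:
  assumes a: "a > 0" and C: "C > 0" and M: "M > 0"
    and b: "b > 0" "b \<le> a / 4" "8 * real n * C * M * (4 * b / a) \<le> 1 - exp (- (a / 2))"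
    and c: "\<And>d i j. i < n \<Longrightarrow> j < n \<Longrightarrow> cmod (c d i j) \<le> C * exp (- a * \<bar>real_of_int d\<bar>)"
    and stab: "\<And>y. L2_set (\<lambda>q. cmod (y q)) (hr_index n N) \<le> M * L2_set (\<lambda>q. cmod (hr_op n w \<omega>f c N y q)) (hr_index n N)"
    and sol: "\<And>q. q \<in> hr_index n N \<Longrightarrow> hr_op n w \<omega>f c N x q = hr_rhs v q"
    and v: "L2_set (\<lambda>q. cmod (hr_rhs v q)) (hr_index n N) \<le> V"
    and q: "q \<in> hr_index n N"
  shows "cmod (x q) \<le> 2 * M * V * exp (- b * \<bar>real_of_int (fst q)\<bar>)"
proof -
  let ?I = "hr_index n N"
  define W where "W q = exp (b * \<bar>real_of_int (fst q)\<bar>)" for q :: "int \<times> nat"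
  define y where "y q = of_real (W q) * x q" for q
  \<comment> \<open>The commutator of the weight with the convolution by c; the diagonal part of the
    operator commutes with the weight.\<close>
  define D where "D q = (\<Sum>r\<in>?I. (of_real (W q) - of_real (W r)) * c (fst q - fst r) (snd q) (snd r) * x r)" for q
  define K where "K q r = C * (4 * b / a) * exp (- (a / 2) * \<bar>real_of_int (fst q - fst r)\<bar>)" for q r :: "int \<times> nat"
  have W0: "W q > 0" for q by (simp add: W_def)
  have op: "hr_op n w \<omega>f c N y q = hr_rhs v q + D q" if q: "q \<in> ?I" for q
  proof -
    have "hr_op n w \<omega>f c N y q = of_real (W q) * hr_op n w \<omega>f c N x q + D q"
      unfolding hr_op_def D_def y_def
      by (simp add: algebra_simps sum_subtractf sum_distrib_left)
    moreover have "of_real (W q) * hr_rhs v q = hr_rhs v q" by (simp add: hr_rhs_def W_def)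
    ultimately show ?thesis using sol[OF q] by simp
  qed
  have K0: "K q r \<ge> 0" for q r using a C b by (simp add: K_def)
  have D: "cmod (D q) \<le> (\<Sum>r\<in>?I. K q r * cmod (y r))" if q: "q \<in> ?I" for q
    unfolding D_def
  proof (rule order_trans[OF norm_sum], rule sum_mono)
    fix r assume r: "r \<in> ?I"
    define d where "d = fst q - fst r"
    \<comment> \<open>Only the distance of the two harmonics will matter, by the reverse triangle
      inequality. Factoring out W r, not W q, reproduces the weighted solution y r inside the
      sum.\<close>
    have "W q - W r = (exp (b * (\<bar>real_of_int (fst q)\<bar> - \<bar>real_of_int (fst r)\<bar>)) - 1) * W r"
      by (simp add: W_def left_diff_distrib right_diff_distrib exp_diff)
    hence "\<bar>W q - W r\<bar> = \<bar>exp (b * (\<bar>real_of_int (fst q)\<bar> - \<bar>real_of_int (fst r)\<bar>)) - 1\<bar> * W r"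
      using W0[of r] by (simp add: abs_mult)
    also have "\<dots> \<le> (exp \<bar>b * (\<bar>real_of_int (fst q)\<bar> - \<bar>real_of_int (fst r)\<bar>)\<bar> - 1) * W r"
      using W0[of r] by (intro mult_right_mono abs_exp_minus_one_le) auto
    also have "\<dots> \<le> (exp (b * \<bar>real_of_int d\<bar>) - 1) * W r"
      using W0[of r] b by (intro mult_right_mono diff_right_mono) (auto simp: abs_mult d_def)
    finally have Wd: "\<bar>W q - W r\<bar> \<le> (exp (b * \<bar>real_of_int d\<bar>) - 1) * W r" .
    have "cmod ((of_real (W q) - of_real (W r)) * c d (snd q) (snd r) * x r)
        = \<bar>W q - W r\<bar> * cmod (c d (snd q) (snd r)) * cmod (x r)"
      by (simp only: norm_mult of_real_diff[symmetric] norm_of_real)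
    also have "\<dots> \<le> ((exp (b * \<bar>real_of_int d\<bar>) - 1) * W r) * (C * exp (- a * \<bar>real_of_int d\<bar>)) * cmod (x r)"
      using Wd q r C b W0[of r] by (intro mult_mono mult_nonneg_nonneg c) (auto simp: hr_index_def)
    also have "\<dots> = C * ((exp (b * \<bar>real_of_int d\<bar>) - 1) * exp (- a * \<bar>real_of_int d\<bar>)) * (W r * cmod (x r))"
      by (simp only: mult_ac)
    also have "\<dots> \<le> C * (4 * b / a * exp (- (a / 2) * \<bar>real_of_int d\<bar>)) * (W r * cmod (x r))"
      using a b C W0[of r] by (intro mult_right_mono mult_left_mono exp_minus_one_mult_le) auto
    also have "\<dots> = K q r * cmod (y r)"
      using W0[of r] by (simp add: K_def d_def y_def norm_mult)
    finally show "cmod ((of_real (W q) - of_real (W r)) * c (fst q - fst r) (snd q) (snd r) * x r) \<le> K q r * cmod (y r)"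
      by (simp add: d_def)
  qed
  \<comment> \<open>A generic injective g covers row and column sums at once: they differ only in a
    shift and a reflection of the harmonic. The factor n counts the components of a block.\<close>
  have sumK: "(\<Sum>r\<in>?I. C * (4 * b / a) * exp (- (a / 2) * \<bar>real_of_int (g (fst r))\<bar>)) \<le> 1 / (2 * M)"
    if g: "inj g" for g :: "int \<Rightarrow> int"
  proof -
    define e where "e = 1 - exp (- (a / 2))"
    have e: "e > 0" using a by (simp add: e_def)
    have "(\<Sum>r\<in>?I. C * (4 * b / a) * exp (- (a / 2) * \<bar>real_of_int (g (fst r))\<bar>))
        = C * (4 * b / a) * (real n * (\<Sum>l\<in>{-int N..int N}. exp (- (a / 2) * \<bar>real_of_int (g l)\<bar>)))"
      by (simp add: hr_index_def sum.cartesian_product' sum_distrib_left mult_ac)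
    also have "(\<Sum>l\<in>{-int N..int N}. exp (- (a / 2) * \<bar>real_of_int (g l)\<bar>))
        = (\<Sum>d\<in>g ` {-int N..int N}. exp (- (a / 2) * \<bar>real_of_int d\<bar>))"
      using g by (subst sum.reindex) (auto intro: inj_on_subset)
    also have "C * (4 * b / a) * (real n * \<dots>) \<le> C * (4 * b / a) * (real n * (2 / e))"
      unfolding e_def using a b C by (intro mult_left_mono sum_exp_abs_int_le) auto
    also have "\<dots> = (8 * real n * C * M * (4 * b / a)) / (4 * M * e)"
      using M by (simp add: field_simps)
    also have "\<dots> \<le> e / (4 * M * e)"
      using b(3) M e by (intro divide_right_mono) (auto simp: e_def)
    also have "\<dots> \<le> 1 / (2 * M)" using M e by (simp add: field_simps)
    finally show ?thesis .
  qed
  have KS: "L2_set (\<lambda>q. \<Sum>r\<in>?I. K q r * cmod (y r)) ?I \<le> 1 / (2 * M) * L2_set (\<lambda>q. cmod (y q)) ?I"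
  proof (rule L2_set_Schur_test)
    fix q
    show "(\<Sum>r\<in>?I. K q r) \<le> 1 / (2 * M)" unfolding K_def by (rule sumK) (auto simp: inj_def)
    show "(\<Sum>r\<in>?I. K r q) \<le> 1 / (2 * M)" unfolding K_def
      by (rule sumK[of "\<lambda>k. k - fst q"]) (auto simp: inj_def)
  qed (use K0 M in auto)
  have "L2_set (\<lambda>q. cmod (y q)) ?I \<le> M * L2_set (\<lambda>q. cmod (hr_op n w \<omega>f c N y q)) ?I" by (rule stab)
  also have "\<dots> \<le> M * L2_set (\<lambda>q. cmod (hr_rhs v q) + (\<Sum>r\<in>?I. K q r * cmod (y r))) ?I"
    using M by (intro mult_left_mono L2_set_mono)
      (auto simp: op intro!: order_trans[OF norm_triangle_ineq] D)
  also have "\<dots> \<le> M * (V + 1 / (2 * M) * L2_set (\<lambda>q. cmod (y q)) ?I)"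
    using M v KS by (intro mult_left_mono order_trans[OF L2_set_triangle_ineq] add_mono) auto
  also have "\<dots> = M * V + L2_set (\<lambda>q. cmod (y q)) ?I / 2"
    using M by (simp add: field_simps)
  \<comment> \<open>Absorbing half of the weighted norm into the left side produces the factor 2 in
    2 M V.\<close>
  finally have "L2_set (\<lambda>q. cmod (y q)) ?I \<le> 2 * M * V" by simp
  moreover have "cmod (y q) \<le> L2_set (\<lambda>q. cmod (y q)) ?I"
    using member_le_L2_set[OF finite_hr_index q, of "\<lambda>q. cmod (y q)"] .
  ultimately have "W q * cmod (x q) \<le> 2 * M * V" using W0[of q] by (simp add: y_def norm_mult)
  hence "cmod (x q) \<le> 2 * M * V / W q" using W0[of q] by (simp add: field_simps)
  thus ?thesis by (simp add: W_def exp_minus field_simps)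
qed

text \<open>Shared by both comparisons below: coefficients decay at rate a over the distance r - s,
  the solution at rate b over s, and the slower rate survives over the whole of r.\<close>

lemma exp_decay_split_le:
  assumes b: "0 \<le> b" "b \<le> a" and "s \<le> r"
  shows "exp (- a * (r - s)) * exp (- b * s) \<le> exp (- b * (r::real))"
proof -
  have "b * (r - s) \<le> a * (r - s)" using assms by (intro mult_right_mono) auto
  thus ?thesis unfolding exp_add[symmetric] by (simp add: algebra_simps)
qed

section \<open>Residuals and the comparison of resolvent solutions\<close>

lemma hr_op_diff: "hr_op n w \<omega>f c N (\<lambda>q. x q - y q) q = hr_op n w \<omega>f c N x q - hr_op n w \<omega>f c N y q"
  by (simp add: hr_op_def algebra_simps sum_subtractf)

text \<open>The solution at level N, padded by zero, almost solves the equation at level N + 1.\<close>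

lemma hr_step_close:
  assumes C: "C > 0" and M: "M > 0" and b: "0 < b" "b \<le> a" and A: "A \<ge> 0"
    and c: "\<And>d i j. i < n \<Longrightarrow> j < n \<Longrightarrow> cmod (c' d i j) \<le> C * exp (- a * \<bar>real_of_int d\<bar>)"
    and cc: "\<And>d i j. i < n \<Longrightarrow> j < n \<Longrightarrow> cmod (c d i j - c' d i j) \<le> 2 * C * exp (- a * real N)"
    and stab: "\<And>y. L2_set (\<lambda>q. cmod (y q)) (hr_index n (Suc N))
                  \<le> M * L2_set (\<lambda>q. cmod (hr_op n w \<omega>f c' (Suc N) y q)) (hr_index n (Suc N))"
    and sol: "\<And>q. q \<in> hr_index n N \<Longrightarrow> hr_op n w \<omega>f c N x q = hr_rhs v q"
    and sol': "\<And>q. q \<in> hr_index n (Suc N) \<Longrightarrow> hr_op n w \<omega>f c' (Suc N) x' q = hr_rhs v q"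
    and decay: "\<And>q. q \<in> hr_index n N \<Longrightarrow> cmod (x q) \<le> A * exp (- b * \<bar>real_of_int (fst q)\<bar>)"
  shows "\<bar>L2_set (\<lambda>q. cmod (x' q)) (hr_index n (Suc N)) - L2_set (\<lambda>q. cmod (x q)) (hr_index n N)\<bar>
    \<le> M * (real ((2 * N + 3) * n) * (real ((2 * N + 1) * n) * (2 * C * A * exp (- b * real N))))"
proof -
  let ?I = "hr_index n N" and ?I' = "hr_index n (Suc N)"
  define z where "z q = (if q \<in> ?I then x q else 0)" for q
  define E where "E = real ((2 * N + 1) * n) * (2 * C * A * exp (- b * real N))"
  have sub: "?I \<subseteq> ?I'" by (auto simp: hr_index_def)
  have zI: "L2_set (\<lambda>q. cmod (z q)) ?I' = L2_set (\<lambda>q. cmod (x q)) ?I"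
  proof -
    have "(\<Sum>q\<in>?I'. (cmod (z q))\<^sup>2) = (\<Sum>q\<in>?I. (cmod (x q))\<^sup>2)"
      by (rule sum.mono_neutral_cong_right) (use sub in \<open>auto simp: z_def\<close>)
    thus ?thesis by (simp add: L2_set_def)
  qed
  have opz: "hr_op n w \<omega>f c' (Suc N) z q = \<i> * of_real (\<omega>f + of_int (fst q) * w) * z q
     - (\<Sum>r\<in>?I. c' (fst q - fst r) (snd q) (snd r) * x r)" for q
  proof -
    have "(\<Sum>r\<in>?I'. c' (fst q - fst r) (snd q) (snd r) * z r) = (\<Sum>r\<in>?I. c' (fst q - fst r) (snd q) (snd r) * x r)"
      by (rule sum.mono_neutral_cong_right) (use sub in \<open>auto simp: z_def\<close>)
    thus ?thesis by (simp add: hr_op_def)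
  qed
  have xA: "cmod (x r) \<le> A" if "r \<in> ?I" for r
    using A b by (intro order_trans[OF decay[OF that]] mult_left_le) auto
  have ab: "exp (- a * real N) \<le> exp (- b * real N)" using b by (simp add: mult_right_mono)
  \<comment> \<open>For an old harmonic the level N equation holds with c, so only the change of
    coefficients remains. In the new block rows, |k| = N + 1, the forcing and z vanish, and what
    remains is the coupling to old harmonics l, at distance at least N - |l|.\<close>
  have E: "cmod (hr_rhs v q - hr_op n w \<omega>f c' (Suc N) z q) \<le> E" if q: "q \<in> ?I'" for q
  proof (cases "q \<in> ?I")
    case True
    have "hr_rhs v q - hr_op n w \<omega>f c' (Suc N) z q = (\<Sum>r\<in>?I. (c' (fst q - fst r) (snd q) (snd r) - c (fst q - fst r) (snd q) (snd r)) * x r)"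
      using True sol[OF True, symmetric] unfolding opz
      by (simp add: hr_op_def z_def algebra_simps sum_subtractf)
    also have "cmod \<dots> \<le> (\<Sum>r\<in>?I. 2 * C * A * exp (- b * real N))"
    proof (rule order_trans[OF norm_sum], rule sum_mono)
      fix r assume r: "r \<in> ?I"
      have "cmod (c' (fst q - fst r) (snd q) (snd r) - c (fst q - fst r) (snd q) (snd r)) \<le> 2 * C * exp (- a * real N)"
        using cc[of "snd q" "snd r" "fst q - fst r"] True r by (auto simp: hr_index_def norm_minus_commute)
      hence "cmod ((c' (fst q - fst r) (snd q) (snd r) - c (fst q - fst r) (snd q) (snd r)) * x r) \<le> 2 * C * exp (- a * real N) * A"
        unfolding norm_mult using xA[OF r] C by (intro mult_mono) auto
      also have "\<dots> \<le> 2 * C * exp (- b * real N) * A"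
        using ab A C by (intro mult_right_mono mult_left_mono) auto
      finally show "cmod ((c' (fst q - fst r) (snd q) (snd r) - c (fst q - fst r) (snd q) (snd r)) * x r) \<le> 2 * C * A * exp (- b * real N)"
        by (simp add: mult_ac)
    qed
    finally show ?thesis by (simp add: E_def card_hr_index)
  next
    case False
    hence k: "\<bar>fst q\<bar> = int N + 1" using q by (auto simp: hr_index_def)
    hence "hr_rhs v q - hr_op n w \<omega>f c' (Suc N) z q = (\<Sum>r\<in>?I. c' (fst q - fst r) (snd q) (snd r) * x r)"
      using False unfolding opz by (auto simp: hr_rhs_def z_def)
    also have "cmod \<dots> \<le> (\<Sum>r\<in>?I. 2 * C * A * exp (- b * real N))"
    proof (rule order_trans[OF norm_sum], rule sum_mono)
      fix r assume r: "r \<in> ?I"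
      let ?s = "\<bar>real_of_int (fst r)\<bar>"
      have s: "?s \<le> real N" using r by (auto simp: hr_index_def)
      have "real N - ?s \<le> \<bar>real_of_int (fst q - fst r)\<bar>" using k by linarith
      hence "a * (real N - ?s) \<le> a * \<bar>real_of_int (fst q - fst r)\<bar>" using b by (intro mult_left_mono) auto
      hence "C * exp (- a * \<bar>real_of_int (fst q - fst r)\<bar>) \<le> C * exp (- a * (real N - ?s))" using C by simp
      hence "cmod (c' (fst q - fst r) (snd q) (snd r)) \<le> C * exp (- a * (real N - ?s))"
        using c[of "snd q" "snd r" "fst q - fst r"] q r by (auto simp: hr_index_def)
      hence "cmod (c' (fst q - fst r) (snd q) (snd r) * x r) \<le> C * exp (- a * (real N - ?s)) * (A * exp (- b * ?s))"
        unfolding norm_mult using decay[OF r] C by (intro mult_mono) auto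
      also have "\<dots> = C * A * (exp (- a * (real N - ?s)) * exp (- b * ?s))" by (simp only: mult_ac)
      also have "\<dots> \<le> C * A * exp (- b * real N)"
        using C A b s by (intro mult_left_mono exp_decay_split_le) auto
      also have "\<dots> \<le> 2 * C * A * exp (- b * real N)" using C A by simp
      finally show "cmod (c' (fst q - fst r) (snd q) (snd r) * x r) \<le> 2 * C * A * exp (- b * real N)" .
    qed
    finally show ?thesis by (simp add: E_def card_hr_index)
  qed
  have "\<bar>L2_set (\<lambda>q. cmod (x' q)) ?I' - L2_set (\<lambda>q. cmod (x q)) ?I\<bar> \<le> L2_set (\<lambda>q. cmod (x' q - z q)) ?I'"
    unfolding zI[symmetric] by (rule L2_set_cmod_diff_le)
  also have "\<dots> \<le> M * L2_set (\<lambda>q. cmod (hr_op n w \<omega>f c' (Suc N) (\<lambda>q. x' q - z q) q)) ?I'" by (rule stab)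
  also have "\<dots> \<le> M * (real (card ?I') * E)"
    using M by (intro mult_left_mono L2_set_le_card_mult) (auto simp: hr_op_diff sol' E)
  finally show ?thesis by (simp add: E_def card_hr_index algebra_simps)
qed

text \<open>The time-spectral matrix acting on functions of a pair (node, component).
  Differentiation enters with a plus sign because it is subtracted in \<open>J_TS\<close>, which is
  itself subtracted.\<close>

definition ts_op :: "nat \<Rightarrow> real \<Rightarrow> real \<Rightarrow> (nat \<Rightarrow> nat \<Rightarrow> nat \<Rightarrow> complex) \<Rightarrow> nat
    \<Rightarrow> (nat \<times> nat \<Rightarrow> complex) \<Rightarrow> nat \<times> nat \<Rightarrow> complex" where
  "ts_op n w \<omega>f Jm p y q = \<i> * of_real \<omega>f * y q - (\<Sum>b<n. Jm (fst q) (snd q) b * y (fst q, b))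
     + of_real w * (\<Sum>k<p. of_real (Dmat p (fst q) k) * y (k, snd q))"

lemma ts_op_diff: "ts_op n w \<omega>f Jm p (\<lambda>q. x q - y q) q = ts_op n w \<omega>f Jm p x q - ts_op n w \<omega>f Jm p y q"
  by (simp add: ts_op_def algebra_simps sum_subtractf)

text \<open>Sample the trigonometric polynomial with coefficients x at the nodes. The differentiation matrix acts exactly on
  it and its norm is preserved, so its residual in the time-spectral equation consists of Fourier tails of the Jacobian,
  weighted by the decaying x.\<close>

lemma hr_ts_close:
  assumes w: "w > 0" and p: "p = 2 * N + 1" and M: "M > 0" and b: "0 < b" "b \<le> a" and A: "A \<ge> 0" and G: "G \<ge> 0"
    and stab: "\<And>y. L2_set (\<lambda>q. cmod (y q)) ({..<p} \<times> {..<n})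
                  \<le> M * L2_set (\<lambda>q. cmod (ts_op n w \<omega>f Jm p y q)) ({..<p} \<times> {..<n})"
    and sol: "\<And>q. q \<in> hr_index n N \<Longrightarrow> hr_op n w \<omega>f c N x q = hr_rhs v q"
    and sol': "\<And>q. q \<in> {..<p} \<times> {..<n} \<Longrightarrow> ts_op n w \<omega>f Jm p y q = of_real (1 / sqrt (real p)) * v (snd q)"
    and decay: "\<And>q. q \<in> hr_index n N \<Longrightarrow> cmod (x q) \<le> A * exp (- b * \<bar>real_of_int (fst q)\<bar>)"
    and tail: "\<And>i e f l. i < p \<Longrightarrow> e < n \<Longrightarrow> f < n \<Longrightarrow> \<bar>l\<bar> \<le> int N \<Longrightarrow>
        cmod (Jm i e f - (\<Sum>k=-int N..int N. c (k - l) e f * fexp w (k - l) (ts_node w p i)))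
          \<le> G * exp (- a * (real N - \<bar>real_of_int l\<bar>))"
  shows "\<bar>L2_set (\<lambda>q. cmod (y q)) ({..<p} \<times> {..<n}) - L2_set (\<lambda>q. cmod (x q)) (hr_index n N)\<bar>
    \<le> M * (real ((2 * N + 1) * n) * (real ((2 * N + 1) * n) * (G * A * exp (- b * real N))))"
proof -
  let ?I = "hr_index n N" and ?T = "{..<p} \<times> {..<n}" and ?Z = "{-int N..int N}"
  let ?e = "\<lambda>k i. fexp w k (ts_node w p i)"
  \<comment> \<open>This factor turns the discrete Parseval identity into an isometry; it is also
    the factor in \<open>B_TS\<close>, so the forcing of harmonic 0 is reproduced exactly at every
    node.\<close>
  define s where "s = complex_of_real (1 / sqrt (real p))"
  have s2: "(cmod s)\<^sup>2 = 1 / real p" by (simp add: s_def p norm_divide power_divide)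
  have s1: "cmod s \<le> 1" by (simp add: s_def p norm_divide)
  define z where "z q = s * (\<Sum>k\<in>?Z. x (k, snd q) * ?e k (fst q))" for q
  define E where "E = real ((2 * N + 1) * n) * (G * A * exp (- b * real N))"
  have zT: "L2_set (\<lambda>q. cmod (z q)) ?T = L2_set (\<lambda>q. cmod (x q)) ?I"
  proof -
    have "(\<Sum>q\<in>?T. (cmod (z q))\<^sup>2) = (\<Sum>e<n. \<Sum>i<p. (cmod (z (i, e)))\<^sup>2)"
      by (subst sum.swap) (simp add: sum.cartesian_product')
    also have "\<dots> = (\<Sum>e<n. \<Sum>k\<in>?Z. (cmod (x (k, e)))\<^sup>2)"
      using ts_parseval[OF w p] p
      by (intro sum.cong refl) (simp add: z_def norm_mult power_mult_distrib s2 sum_distrib_left[symmetric] sum_divide_distrib[symmetric])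
    also have "\<dots> = (\<Sum>q\<in>?I. (cmod (x q))\<^sup>2)"
      by (subst sum.swap) (simp add: sum.cartesian_product' hr_index_def)
    finally show ?thesis by (simp add: L2_set_def)
  qed
  have E: "cmod (of_real (1 / sqrt (real p)) * v (snd q) - ts_op n w \<omega>f Jm p z q) \<le> E" if q: "q \<in> ?T" for q
  proof -
    obtain i e where ie: "q = (i, e)" "i < p" "e < n" using q by auto
    have der: "(\<Sum>k<p. of_real (Dmat p i k) * z (k, e)) = s * (\<Sum>l\<in>?Z. x (l, e) * (\<i> * of_int l * ?e l i))"
    proof -
      have "(\<Sum>k<p. of_real (Dmat p i k) * z (k, e)) = (\<Sum>k<p. \<Sum>l\<in>?Z. s * x (l, e) * (of_real (Dmat p i k) * ?e l k))"
        by (simp add: z_def sum_distrib_left mult_ac)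
      also have "\<dots> = (\<Sum>l\<in>?Z. s * x (l, e) * (\<Sum>k<p. of_real (Dmat p i k) * ?e l k))"
        by (subst sum.swap) (simp add: sum_distrib_left)
      also have "\<dots> = (\<Sum>l\<in>?Z. s * x (l, e) * (\<i> * of_int l * ?e l i))"
        by (intro sum.cong refl arg_cong2[of _ _ _ _ "(*)"] Dmat_fexp[OF w p ie(2)]) auto
      finally show ?thesis by (simp add: sum_distrib_left mult_ac)
    qed
    \<comment> \<open>Apart from the Jacobian, the operator acts on each harmonic as in the harmonic
      equation, which therefore trades this part for the forcing plus the convolution with
      c.\<close>
    have "\<i> * of_real \<omega>f * z (i, e) + of_real w * (\<Sum>k<p. of_real (Dmat p i k) * z (k, e))
        = s * (\<Sum>l\<in>?Z. (\<i> * of_real (\<omega>f + of_int l * w) * x (l, e)) * ?e l i)"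
      unfolding der unfolding z_def by (simp add: sum_distrib_left sum.distrib algebra_simps)
    also have "(\<Sum>l\<in>?Z. (\<i> * of_real (\<omega>f + of_int l * w) * x (l, e)) * ?e l i)
        = (\<Sum>l\<in>?Z. (hr_rhs v (l, e) + (\<Sum>r\<in>?I. c (l - fst r) e (snd r) * x r)) * ?e l i)"
    proof (intro sum.cong refl)
      fix l assume "l \<in> ?Z"
      hence "(l, e) \<in> ?I" using ie by (simp add: hr_index_def)
      from sol[OF this] show "(\<i> * of_real (\<omega>f + of_int l * w) * x (l, e)) * ?e l i
          = (hr_rhs v (l, e) + (\<Sum>r\<in>?I. c (l - fst r) e (snd r) * x r)) * ?e l i"
        by (simp add: hr_op_def diff_eq_eq)
    qed
    also have "\<dots> = (\<Sum>l\<in>?Z. hr_rhs v (l, e) * ?e l i) + (\<Sum>l\<in>?Z. \<Sum>r\<in>?I. c (l - fst r) e (snd r) * x r * ?e l i)"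
      by (simp add: distrib_right sum.distrib sum_distrib_right)
    also have "(\<Sum>l\<in>?Z. hr_rhs v (l, e) * ?e l i) = (\<Sum>l\<in>?Z. if l = 0 then v e else 0)"
      by (intro sum.cong) (auto simp: hr_rhs_def)
    also have "\<dots> = v e" by (subst sum.delta) auto
    \<comment> \<open>Splitting the exponential of l into those of k = \<open>fst r\<close> and l -
      k turns the convolution into a truncated Fourier series of the Jacobian over a window shifted
      by k. Its distance from \<open>Jm\<close> is what \<open>tail\<close> bounds.\<close>
    also have "(\<Sum>l\<in>?Z. \<Sum>r\<in>?I. c (l - fst r) e (snd r) * x r * ?e l i)
        = (\<Sum>r\<in>?I. x r * ?e (fst r) i * (\<Sum>l\<in>?Z. c (l - fst r) e (snd r) * ?e (l - fst r) i))"
    proof -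
      have "c (l - fst r) e (snd r) * x r * ?e l i = x r * ?e (fst r) i * (c (l - fst r) e (snd r) * ?e (l - fst r) i)"
        for l r
        using fexp_add[of w "fst r" "l - fst r" "ts_node w p i"] by simp
      thus ?thesis by (subst sum.swap) (simp only: sum_distrib_left)
    qed
    finally have 1: "\<i> * of_real \<omega>f * z (i, e) + of_real w * (\<Sum>k<p. of_real (Dmat p i k) * z (k, e))
        = s * (v e + (\<Sum>r\<in>?I. x r * ?e (fst r) i * (\<Sum>l\<in>?Z. c (l - fst r) e (snd r) * ?e (l - fst r) i)))" .
    have 2: "(\<Sum>f<n. Jm i e f * z (i, f)) = s * (\<Sum>r\<in>?I. x r * ?e (fst r) i * Jm i e (snd r))"
    proof -
      have "(\<Sum>f<n. Jm i e f * z (i, f)) = (\<Sum>f<n. \<Sum>k\<in>?Z. s * (x (k, f) * ?e k i * Jm i e f))"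
        by (simp add: z_def sum_distrib_left mult_ac)
      also have "\<dots> = s * (\<Sum>r\<in>?I. x r * ?e (fst r) i * Jm i e (snd r))"
        by (subst sum.swap) (simp add: sum_distrib_left sum.cartesian_product' hr_index_def)
      finally show ?thesis .
    qed
    have "s * v e - ts_op n w \<omega>f Jm p z (i, e)
        = s * (\<Sum>r\<in>?I. x r * ?e (fst r) i * (Jm i e (snd r) - (\<Sum>l\<in>?Z. c (l - fst r) e (snd r) * ?e (l - fst r) i)))"
    proof -
      have "s * v e - ts_op n w \<omega>f Jm p z (i, e) = s * v e - (\<i> * of_real \<omega>f * z (i, e) + of_real w * (\<Sum>k<p. of_real (Dmat p i k) * z (k, e)))
          + (\<Sum>f<n. Jm i e f * z (i, f))" by (simp add: ts_op_def)
      thus ?thesis unfolding 1 2 by (simp add: right_diff_distrib distrib_left sum_subtractf)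
    qed
    hence "cmod (s * v e - ts_op n w \<omega>f Jm p z (i, e)) \<le> 1 * cmod (\<Sum>r\<in>?I. x r * ?e (fst r) i * (Jm i e (snd r) - (\<Sum>l\<in>?Z. c (l - fst r) e (snd r) * ?e (l - fst r) i)))"
      using mult_right_mono[OF s1 norm_ge_zero] by (simp only: norm_mult)
    also have "\<dots> \<le> (\<Sum>r\<in>?I. G * A * exp (- b * real N))"
      unfolding mult_1
    proof (rule order_trans[OF norm_sum], rule sum_mono)
      fix r assume r: "r \<in> ?I"
      let ?s = "\<bar>real_of_int (fst r)\<bar>"
      have s: "?s \<le> real N" using r by (auto simp: hr_index_def)
      have "cmod (x r * ?e (fst r) i * (Jm i e (snd r) - (\<Sum>l\<in>?Z. c (l - fst r) e (snd r) * ?e (l - fst r) i)))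
          \<le> (A * exp (- b * ?s)) * (G * exp (- a * (real N - ?s)))"
        unfolding norm_mult norm_fexp mult_1_right
        using r ie A decay[OF r] by (intro mult_mono tail) (auto simp: hr_index_def)
      also have "\<dots> = G * A * (exp (- a * (real N - ?s)) * exp (- b * ?s))" by (simp only: mult_ac)
      also have "\<dots> \<le> G * A * exp (- b * real N)"
        using G A b s by (intro mult_left_mono exp_decay_split_le) auto
      finally show "cmod (x r * ?e (fst r) i * (Jm i e (snd r) - (\<Sum>l\<in>?Z. c (l - fst r) e (snd r) * ?e (l - fst r) i)))
          \<le> G * A * exp (- b * real N)" .
    qed
    finally show ?thesis by (simp add: E_def card_hr_index s_def ie)
  qed
  have "\<bar>L2_set (\<lambda>q. cmod (y q)) ?T - L2_set (\<lambda>q. cmod (x q)) ?I\<bar> \<le> L2_set (\<lambda>q. cmod (y q - z q)) ?T"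
    unfolding zT[symmetric] by (rule L2_set_cmod_diff_le)
  also have "\<dots> \<le> M * L2_set (\<lambda>q. cmod (ts_op n w \<omega>f Jm p (\<lambda>q. y q - z q) q)) ?T" by (rule stab)
  also have "\<dots> \<le> M * (real (card ?T) * E)"
  proof (intro mult_left_mono L2_set_le_card_mult)
    fix q assume q: "q \<in> ?T"
    show "\<bar>cmod (ts_op n w \<omega>f Jm p (\<lambda>q. y q - z q) q)\<bar> \<le> E"
      unfolding ts_op_diff sol'[OF q] using E[OF q] by simp
  qed (use M in auto)
  finally show ?thesis by (simp add: E_def card_cartesian_product p)
qed

section \<open>From block matrices to indexed families\<close>

lemma vnorm2_vec_bij:
  assumes f: "bij_betw f {..<D} I"
  shows "vnorm2 (vec D (\<lambda>r. y (f r))) = L2_set (\<lambda>q. cmod (y q)) I"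
proof -
  have "(\<Sum>r<D. (cmod (y (f r)))\<^sup>2) = (\<Sum>q\<in>I. (cmod (y q))\<^sup>2)"
    using sum.reindex_bij_betw[OF f, of "\<lambda>q. (cmod (y q))\<^sup>2"] .
  thus ?thesis by (simp add: vnorm2_def L2_set_def)
qed

text \<open>In the coordinates f, \<open>op\<close> is the matrix L, so y = L^-1 (L y) gives an
  estimate for every family y. This freedom is used for weighted solutions and for errors, neither
  of which solves the original equation.\<close>

lemma mat_stability_reindexed:
  assumes f: "bij_betw f {..<D} I" and L: "L \<in> carrier_mat D D" "invertible_mat L" "opnorm2 (mat_inv L) \<le> M"
    and op: "\<And>y r. r < D \<Longrightarrow> op y (f r) = (\<Sum>s<D. L $$ (r,s) * y (f s))"
  shows "L2_set (\<lambda>q. cmod (y q)) I \<le> M * L2_set (\<lambda>q. cmod (op y q)) I"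
proof -
  note inv = mat_inv_inverse[OF L(1,2)]
  let ?y = "vec D (\<lambda>r. y (f r))" and ?z = "vec D (\<lambda>r. op y (f r))"
  have "L *\<^sub>v ?y = ?z" using L(1) op by (intro eq_vecI) (auto simp: scalar_prod_def atLeast0LessThan)
  hence "?y = mat_inv L *\<^sub>v ?z"
    using assoc_mult_mat_vec[OF inv(1) L(1), of ?y] inv(3) by simp
  hence "vnorm2 ?y \<le> opnorm2 (mat_inv L) * vnorm2 ?z"
    using vnorm2_mult_mat_vec_le[OF inv(1), of ?z] by simp
  also have "\<dots> \<le> M * vnorm2 ?z" using L(3) by (intro mult_right_mono) auto
  finally show ?thesis unfolding vnorm2_vec_bij[OF f] .
qed

text \<open>The solution vector is transported along f. Its values outside I are unspecified, which
  is harmless since \<open>op\<close> at points of I sees only values on I.\<close>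

lemma mat_solution_reindexed:
  assumes f: "bij_betw f {..<D} I" and L: "L \<in> carrier_mat D D" "invertible_mat L"
    and R: "R \<in> carrier_mat D m" and u: "u \<in> carrier_vec m"
    and op: "\<And>y r. r < D \<Longrightarrow> op y (f r) = (\<Sum>s<D. L $$ (r,s) * y (f s))"
    and rhs: "\<And>r. r < D \<Longrightarrow> rhs (f r) = (R *\<^sub>v u) $ r"
  obtains x where "\<And>q. q \<in> I \<Longrightarrow> op x q = rhs q"
    "L2_set (\<lambda>q. cmod (x q)) I = vnorm2 ((mat_inv L * R) *\<^sub>v u)"
proof
  note inv = mat_inv_inverse[OF L]
  define v where "v = (mat_inv L * R) *\<^sub>v u"
  define x where "x q = v $ inv_into {..<D} f q" for q
  have v: "v \<in> carrier_vec D" using inv(1) R u by (auto simp: v_def)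
  have xf: "x (f r) = v $ r" if "r < D" for r
    using bij_betw_imp_inj_on[OF f] that by (simp add: x_def inv_into_f_f)
  have "vec D (\<lambda>r. x (f r)) = v" using v xf by (intro eq_vecI) auto
  thus "L2_set (\<lambda>q. cmod (x q)) I = vnorm2 ((mat_inv L * R) *\<^sub>v u)"
    using vnorm2_vec_bij[OF f, of x] by (simp add: v_def)
  have "L *\<^sub>v v = (L * (mat_inv L * R)) *\<^sub>v u"
    unfolding v_def using assoc_mult_mat_vec[OF L(1) _ u, of "mat_inv L * R"] inv(1) R by simp
  also have "L * (mat_inv L * R) = R" using assoc_mult_mat[OF L(1) inv(1) R] inv(2) R by simp
  finally have Lv: "L *\<^sub>v v = R *\<^sub>v u" .
  fix q assume "q \<in> I"
  then obtain r where r: "r < D" "q = f r" using f by (auto simp: bij_betw_def)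
  have "op x q = (L *\<^sub>v v) $ r"
    using op[OF r(1)] r mult_mat_vec_index_sum[OF L(1) v r(1)] by (simp add: xf)
  thus "op x q = rhs q" using rhs[OF r(1)] r Lv by simp
qed

lemma bij_betw_div_mod:
  fixes n p :: nat
  assumes "n \<ge> 1"
  shows "bij_betw (\<lambda>r. (r div n, r mod n)) {..<p * n} ({..<p} \<times> {..<n})"
proof (rule bij_betwI[where g = "\<lambda>(i, a). i * n + a"])
  show "(\<lambda>(i, a). i * n + a) \<in> {..<p} \<times> {..<n} \<rightarrow> {..<p * n}"
  proof clarsimp
    fix i a assume "i < p" "a < n"
    hence "i * n + a < Suc i * n" by simp
    also have "\<dots> \<le> p * n" using \<open>i < p\<close> by (intro mult_right_mono) auto
    finally show "i * n + a < p * n" .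
  qed
qed (use assms in \<open>auto simp: less_mult_imp_div_less\<close>)

lemma bij_betw_hr_index:
  assumes "n \<ge> 1"
  shows "bij_betw (\<lambda>r. (int (r div n) - int N, r mod n)) {..<(2 * N + 1) * n} (hr_index n N)"
proof -
  have "bij_betw (\<lambda>(i, a). (int i - int N, a)) ({..<2 * N + 1} \<times> {..<n}) (hr_index n N)"
    by (rule bij_betwI[where g = "\<lambda>(k, a). (nat (k + int N), a)"]) (auto simp: hr_index_def)
  from bij_betw_trans[OF bij_betw_div_mod[OF assms] this] show ?thesis
    by (simp add: o_def)
qed

lemma hr_op_eq_L_HR:
  assumes n: "n \<ge> 1" and r: "r < (2 * N + 1) * n"
  shows "hr_op n w \<omega>f (\<lambda>d a b. fourier_coeff n w Jf d $$ (a,b)) N y (int (r div n) - int N, r mod n)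
    = (\<Sum>s<(2 * N + 1) * n. L_HR n w \<omega>f Jf N $$ (r,s) * y (int (s div n) - int N, s mod n))"
proof -
  let ?f = "\<lambda>r. (int (r div n) - int N, r mod n)" and ?D = "(2 * N + 1) * n"
  have bij: "bij_betw ?f {..<?D} (hr_index n N)" by (rule bij_betw_hr_index[OF n])
  have inj: "?f r = ?f s \<longleftrightarrow> s = r" if "s < ?D" for s
    using inj_on_eq_iff[OF bij_betw_imp_inj_on[OF bij], of r s] r that by auto
  have "(\<Sum>s<?D. L_HR n w \<omega>f Jf N $$ (r,s) * y (?f s))
      = (\<Sum>s<?D. (if s = r then \<i> * of_real (\<omega>f + of_int (fst (?f r)) * w) * y (?f r) else 0)
          - fourier_coeff n w Jf (fst (?f r) - fst (?f s)) $$ (snd (?f r), snd (?f s)) * y (?f s))"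
  proof (rule sum.cong[OF refl])
    fix s assume "s \<in> {..<?D}"
    thus "L_HR n w \<omega>f Jf N $$ (r,s) * y (?f s) = (if s = r then \<i> * of_real (\<omega>f + of_int (fst (?f r)) * w) * y (?f r) else 0)
          - fourier_coeff n w Jf (fst (?f r) - fst (?f s)) $$ (snd (?f r), snd (?f s)) * y (?f s)"
      using inj[of s] r by (auto simp: L_HR_def Let_def left_diff_distrib)
  qed
  also have "\<dots> = \<i> * of_real (\<omega>f + of_int (fst (?f r)) * w) * y (?f r)
      - (\<Sum>s<?D. fourier_coeff n w Jf (fst (?f r) - fst (?f s)) $$ (snd (?f r), snd (?f s)) * y (?f s))"
    unfolding sum_subtractf using r by (subst sum.delta) auto
  also have "(\<Sum>s<?D. fourier_coeff n w Jf (fst (?f r) - fst (?f s)) $$ (snd (?f r), snd (?f s)) * y (?f s))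
      = (\<Sum>q\<in>hr_index n N. fourier_coeff n w Jf (fst (?f r) - fst q) $$ (snd (?f r), snd q) * y q)"
    by (rule sum.reindex_bij_betw[OF bij])
  finally show ?thesis by (simp add: hr_op_def)
qed

lemma hr_rhs_eq_B_HR:
  assumes n: "n \<ge> 1" and B: "B \<in> carrier_mat n m" and u: "u \<in> carrier_vec m" and r: "r < (2 * N + 1) * n"
  shows "hr_rhs (\<lambda>a. (B *\<^sub>v u) $ a) (int (r div n) - int N, r mod n) = (B_HR n m B N *\<^sub>v u) $ r"
proof -
  have BH: "B_HR n m B N \<in> carrier_mat ((2 * N + 1) * n) m" by (simp add: B_HR_def)
  have rn: "r mod n < n" using n by simp
  show ?thesis
    unfolding mult_mat_vec_index_sum[OF BH u r] using r
    by (auto simp: hr_rhs_def B_HR_def mult_mat_vec_index_sum[OF B u rn] simp del: index_mult_mat_vec)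
qed

lemma ts_op_eq_L_TS:
  assumes n: "n \<ge> 1" and r: "r < p * n"
  shows "ts_op n w \<omega>f (\<lambda>i a b. Jf (ts_node w p i) $$ (a,b)) p y (r div n, r mod n)
    = (\<Sum>s<p * n. L_TS n w \<omega>f Jf p $$ (r,s) * y (s div n, s mod n))"
proof -
  let ?f = "\<lambda>r. (r div n, r mod n)" and ?D = "p * n"
  let ?J = "\<lambda>i a b. Jf (ts_node w p i) $$ (a,b)"
  define i a where "i = r div n" and "a = r mod n"
  have ia: "i < p" "a < n" using r n by (auto simp: i_def a_def less_mult_imp_div_less)
  have bij: "bij_betw ?f {..<?D} ({..<p} \<times> {..<n})" by (rule bij_betw_div_mod[OF n])
  have inj: "?f r = ?f s \<longleftrightarrow> s = r" if "s < ?D" for s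
    using inj_on_eq_iff[OF bij_betw_imp_inj_on[OF bij], of r s] r that by auto
  \<comment> \<open>The Jacobian part is diagonal in the node and the differentiation part is
    diagonal in the component, so after reindexing each loses one of its two sums.\<close>
  define g where "g q = (if fst q = i then ?J i a (snd q) * y (i, snd q) else 0)
      - of_real w * (if snd q = a then of_real (Dmat p i (fst q)) * y (fst q, a) else 0)" for q
  have "(\<Sum>s<?D. L_TS n w \<omega>f Jf p $$ (r,s) * y (?f s))
      = (\<Sum>s<?D. (if s = r then \<i> * of_real \<omega>f * y (i, a) else 0) - g (?f s))"
  proof (rule sum.cong[OF refl])
    fix s assume "s \<in> {..<?D}"
    thus "L_TS n w \<omega>f Jf p $$ (r,s) * y (?f s) = (if s = r then \<i> * of_real \<omega>f * y (i, a) else 0) - g (?f s)"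
      using inj[of s] r
      by (auto simp: L_TS_def J_TS_def g_def i_def a_def ts_node_def algebra_simps)
  qed
  also have "\<dots> = \<i> * of_real \<omega>f * y (i, a) - (\<Sum>s<?D. g (?f s))"
    unfolding sum_subtractf using r by (subst sum.delta) auto
  also have "(\<Sum>s<?D. g (?f s)) = (\<Sum>q\<in>{..<p} \<times> {..<n}. g q)"
    by (rule sum.reindex_bij_betw[OF bij])
  also have "\<dots> = (\<Sum>k<p. \<Sum>b<n. if k = i then ?J i a b * y (i, b) else 0)
      - (\<Sum>k<p. \<Sum>b<n. of_real w * (if b = a then of_real (Dmat p i k) * y (k, a) else 0))"
    by (simp add: g_def sum.cartesian_product' sum_subtractf cong: if_cong)
  also have "(\<Sum>k<p. \<Sum>b<n. if k = i then ?J i a b * y (i, b) else 0) = (\<Sum>b<n. ?J i a b * y (i, b))"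
    using ia by (subst sum.swap) (simp add: sum.delta)
  also have "(\<Sum>k<p. \<Sum>b<n. of_real w * (if b = a then of_real (Dmat p i k) * y (k, a) else 0))
      = of_real w * (\<Sum>k<p. of_real (Dmat p i k) * y (k, a))"
    using ia by (simp add: sum_distrib_left[symmetric] sum.delta)
  finally show ?thesis by (simp add: ts_op_def i_def a_def)
qed

lemma ts_rhs_eq_B_TS:
  assumes n: "n \<ge> 1" and B: "B \<in> carrier_mat n m" and u: "u \<in> carrier_vec m" and r: "r < p * n"
  shows "of_real (1 / sqrt (real p)) * (B *\<^sub>v u) $ (r mod n) = (B_TS n m B p *\<^sub>v u) $ r"
proof -
  have BT: "B_TS n m B p \<in> carrier_mat (p * n) m" by (simp add: B_TS_def)
  have rn: "r mod n < n" using n by simp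
  show ?thesis
    unfolding mult_mat_vec_index_sum[OF BT u r] mult_mat_vec_index_sum[OF B u rn] using r
    by (simp add: B_TS_def sum_distrib_left mult.assoc)
qed

section \<open>Forcing, Fourier coefficients and convergence rates\<close>

lemma L2_set_hr_rhs_le:
  assumes B: "B \<in> carrier_mat n m" and u: "u \<in> carrier_vec m" "vnorm2 u \<le> 1"
  shows "L2_set (\<lambda>q. cmod (hr_rhs (\<lambda>a. (B *\<^sub>v u) $ a) q)) (hr_index n N) \<le> opnorm2 B"
proof -
  let ?v = "B *\<^sub>v u"
  have "(\<Sum>q\<in>hr_index n N. (cmod (hr_rhs (\<lambda>a. ?v $ a) q))\<^sup>2)
      = (\<Sum>k=-int N..int N. if k = 0 then \<Sum>a<n. (cmod (?v $ a))\<^sup>2 else 0)"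
    unfolding hr_index_def sum.cartesian_product' by (intro sum.cong) (auto simp: hr_rhs_def)
  also have "\<dots> = (\<Sum>a<n. (cmod (?v $ a))\<^sup>2)" by (subst sum.delta) auto
  finally have "L2_set (\<lambda>q. cmod (hr_rhs (\<lambda>a. ?v $ a) q)) (hr_index n N) = vnorm2 ?v"
    using B by (simp add: L2_set_def vnorm2_def)
  thus ?thesis using vnorm2_le_opnorm2[OF B u] by simp
qed

lemma fourier_coeff_has_integral:
  assumes w: "w > 0" and ab: "a < n" "b < n" and cont: "continuous_on UNIV (\<lambda>t. Jf t $$ (a,b))"
  shows "((\<lambda>t. Jf t $$ (a,b) * fexp w (- k) t) has_integral (of_real (T0 w) * fourier_coeff n w Jf k $$ (a,b))) {0..T0 w}"
proof -
  have "(\<lambda>t. Jf t $$ (a,b) * exp (- \<i> * of_int k * of_real w * of_real t)) = (\<lambda>t. Jf t $$ (a,b) * fexp w (- k) t)"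
    by (simp add: fexp_def)
  moreover have "T0 w \<noteq> 0" using w by (simp add: T0_def)
  ultimately have "of_real (T0 w) * fourier_coeff n w Jf k $$ (a,b) = integral {0..T0 w} (\<lambda>t. Jf t $$ (a,b) * fexp w (- k) t)"
    using ab by (simp add: fourier_coeff_def)
  thus ?thesis
    by (auto intro!: integrable_integral integrable_continuous_interval continuous_intros continuous_on_subset[OF cont])
qed

text \<open>Telescoping and a geometric series bound the distance from N to N + K uniformly in K,
  and K may then tend to infinity. Steps are controlled from N = 1 on, where the hypotheses on the
  Jacobians begin.\<close>

lemma limit_of_exp_small_steps:
  fixes s :: "nat \<Rightarrow> real"
  assumes g: "g > 0" and step: "\<And>N. N \<ge> 1 \<Longrightarrow> \<bar>s (Suc N) - s N\<bar> \<le> Q * exp (- g * real N)"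
  obtains L where "s \<longlonglongrightarrow> L" "\<And>N. N \<ge> 1 \<Longrightarrow> \<bar>s N - L\<bar> \<le> Q / (1 - exp (- g)) * exp (- g * real N)"
proof -
  have q: "exp (- g) < 1" using g by simp
  have Q: "Q \<ge> 0" using order_trans[OF abs_ge_zero step[of 1]] by (simp add: zero_le_mult_iff)
  have diff: "\<bar>s (N + K) - s N\<bar> \<le> Q / (1 - exp (- g)) * exp (- g * real N)" if N: "N \<ge> 1" for N K
  proof -
    have "s (N + K) - s N = (\<Sum>j<K. s (Suc (N + j)) - s (N + j))"
      by (induction K) auto
    also have "\<bar>\<dots>\<bar> \<le> (\<Sum>j<K. Q * exp (- g * real N) * exp (- g) ^ j)"
    proof (rule order_trans[OF sum_abs], rule sum_mono)
      fix j
      have "\<bar>s (Suc (N + j)) - s (N + j)\<bar> \<le> Q * exp (- g * real (N + j))" using N by (intro step) simp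
      also have "exp (- g * real (N + j)) = exp (- g * real N) * exp (- g) ^ j"
        by (simp add: exp_of_nat_mult[symmetric] exp_add[symmetric] algebra_simps)
      finally show "\<bar>s (Suc (N + j)) - s (N + j)\<bar> \<le> Q * exp (- g * real N) * exp (- g) ^ j" by simp
    qed
    also have "\<dots> = Q * exp (- g * real N) * (\<Sum>j<K. exp (- g) ^ j)" by (simp add: sum_distrib_left)
    also have "\<dots> \<le> Q * exp (- g * real N) * (1 / (1 - exp (- g)))"
      using Q q sum_le_suminf[of "\<lambda>j. exp (- g) ^ j" "{..<K}"]
      by (intro mult_left_mono) (auto simp: suminf_geometric summable_geometric)
    finally show ?thesis by simp
  qed
  have "Cauchy s"
  proof (rule metric_CauchyI)
    fix e :: real assume e: "e > 0"
    have "(\<lambda>N. Q / (1 - exp (- g)) * exp (- g) ^ N) \<longlonglongrightarrow> Q / (1 - exp (- g)) * 0"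
      using q by (intro tendsto_intros LIMSEQ_power_zero) auto
    hence "eventually (\<lambda>N. Q / (1 - exp (- g)) * exp (- g) ^ N < e / 2) sequentially"
      using e by (intro order_tendstoD) auto
    then obtain N0 where N0: "\<And>N. N \<ge> N0 \<Longrightarrow> Q / (1 - exp (- g)) * exp (- g) ^ N < e / 2"
      by (auto simp: eventually_sequentially)
    define N where "N = Suc N0"
    have N: "N \<ge> 1" "N \<ge> N0" by (auto simp: N_def)
    have "exp (- g * real N) = exp (- g) ^ N" by (simp add: exp_of_nat_mult[symmetric] mult.commute)
    hence small: "\<bar>s m - s N\<bar> < e / 2" if "m \<ge> N" for m
      using le_less_trans[OF diff[OF N(1), of "m - N"], of "e / 2"] N0[OF N(2)] that by simp
    show "\<exists>M. \<forall>m\<ge>M. \<forall>k\<ge>M. dist (s m) (s k) < e"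
    proof (intro exI allI impI)
      fix m k assume "m \<ge> N" "k \<ge> N"
      thus "dist (s m) (s k) < e" using small[of m] small[of k] by (auto simp: dist_real_def abs_if split: if_splits)
    qed
  qed
  then obtain L where L: "s \<longlonglongrightarrow> L" using real_Cauchy_convergent convergent_def by blast
  have "\<bar>s N - L\<bar> \<le> Q / (1 - exp (- g)) * exp (- g * real N)" if N: "N \<ge> 1" for N
  proof (rule LIMSEQ_le_const2)
    show "(\<lambda>K. \<bar>s N - s (N + K)\<bar>) \<longlonglongrightarrow> \<bar>s N - L\<bar>"
      using LIMSEQ_ignore_initial_segment[OF L, of N] by (intro tendsto_intros) (simp add: add.commute)
    show "\<exists>K0. \<forall>K\<ge>K0. \<bar>s N - s (N + K)\<bar> \<le> Q / (1 - exp (- g)) * exp (- g * real N)"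
      using diff[OF N] by (auto simp: abs_minus_commute)
  qed
  with L show ?thesis using that by blast
qed

text \<open>The inequality x \<le> exp(x) at x = bN/4 gives 2N \<le> (8/b) exp(bN/4); squaring uses
  up exp(bN/2), half of the available decay.\<close>

lemma square_mult_exp_le:
  assumes b: "b > (0::real)"
  shows "(2 * real N + 3)\<^sup>2 * exp (- b * real N) \<le> (3 + 8 / b)\<^sup>2 * exp (- (b / 2) * real N)"
proof -
  have "b * real N / 4 \<le> exp (b * real N / 4)" using exp_ge_add_one_self[of "b * real N / 4"] by linarith
  hence "2 * real N \<le> 8 / b * exp (b * real N / 4)" using b by (simp add: field_simps)
  moreover have "1 \<le> exp (b * real N / 4)" using b by simp
  ultimately have "2 * real N + 3 \<le> (3 + 8 / b) * exp (b * real N / 4)"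
    unfolding distrib_right by linarith
  hence "(2 * real N + 3)\<^sup>2 \<le> ((3 + 8 / b) * exp (b * real N / 4))\<^sup>2" by (intro power_mono) auto
  also have "\<dots> = (3 + 8 / b)\<^sup>2 * exp (b * real N / 2)"
    by (simp add: power_mult_distrib exp_double[symmetric])
  finally have "(2 * real N + 3)\<^sup>2 * exp (- b * real N) \<le> (3 + 8 / b)\<^sup>2 * exp (b * real N / 2) * exp (- b * real N)"
    by (intro mult_right_mono) auto
  also have "\<dots> = (3 + 8 / b)\<^sup>2 * exp (- (b / 2) * real N)"
    by (simp add: mult.assoc exp_add[symmetric])
  finally show ?thesis .
qed

theorem mainTheorem2:
  fixes n m :: nat and B :: "complex mat" and \<omega>0 \<omega>f :: real
    and J :: "nat \<Rightarrow> real \<Rightarrow> complex mat" and Jinf :: "real \<Rightarrow> complex mat"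
    and C M \<alpha> :: real
  assumes n_pos: "n \<ge> 1" and m_pos: "m \<ge> 1" and B_dim: "B \<in> carrier_mat n m"
    and w0_pos: "\<omega>0 > 0"
    and J_dim: "\<forall>N\<ge>1. \<forall>t. J N t \<in> carrier_mat n n" and Jinf_dim: "\<forall>t. Jinf t \<in> carrier_mat n n"
    and J_cont: "\<forall>N\<ge>1. \<forall>a<n. \<forall>b<n. continuous_on UNIV (\<lambda>t. J N t $$ (a,b))"
    and Jinf_cont: "\<forall>a<n. \<forall>b<n. continuous_on UNIV (\<lambda>t. Jinf t $$ (a,b))"
    and J_per: "\<forall>N\<ge>1. \<forall>t. J N (t + T0 \<omega>0) = J N t"
    and Jinf_per: "\<forall>t. Jinf (t + T0 \<omega>0) = Jinf t"
    and consts_pos: "C > 0" "M > 0" "\<alpha> > 0"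
    and J1: "\<forall>N\<ge>1. \<forall>k::int. opnorm2 (fourier_coeff n \<omega>0 (J N) k) \<le> C * exp (- \<alpha> * \<bar>real_of_int k\<bar>)"
    and J1inf: "\<forall>k::int. opnorm2 (fourier_coeff n \<omega>0 Jinf k) \<le> C * exp (- \<alpha> * \<bar>real_of_int k\<bar>)"
    and J2: "\<forall>N\<ge>1. \<forall>k::int. \<bar>k\<bar> \<le> int N \<longrightarrow>
               opnorm2 (fourier_coeff n \<omega>0 (J N) k - fourier_coeff n \<omega>0 Jinf k) \<le> C * exp (- \<alpha> * real N)"
    and J3_HR: "\<forall>N\<ge>1. invertible_mat (L_HR n \<omega>0 \<omega>f (J N) N)
                   \<and> opnorm2 (mat_inv (L_HR n \<omega>0 \<omega>f (J N) N)) \<le> M"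
    and J3_A: "\<forall>N\<ge>1. \<forall>k::int. invertible_mat (A_k n \<omega>0 \<omega>f (J N) k)
                   \<and> opnorm2 (mat_inv (A_k n \<omega>0 \<omega>f (J N) k)) \<le> M"
    and analytic: "\<exists>\<rho>>0. \<exists>F :: nat \<Rightarrow> complex \<Rightarrow> nat \<Rightarrow> nat \<Rightarrow> complex. \<exists>Finf :: complex \<Rightarrow> nat \<Rightarrow> nat \<Rightarrow> complex.
        \<exists>K. (\<forall>N\<ge>1. \<forall>a<n. \<forall>b<n.
               (\<lambda>z. F N z a b) holomorphic_on {z. \<bar>Im z\<bar> < \<rho>}
             \<and> (\<forall>t::real. F N (of_real t) a b = J N t $$ (a,b))
             \<and> (\<forall>z. \<bar>Im z\<bar> < \<rho> \<longrightarrow> cmod (F N z a b) \<le> K))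
          \<and> (\<forall>a<n. \<forall>b<n.
               (\<lambda>z. Finf z a b) holomorphic_on {z. \<bar>Im z\<bar> < \<rho>}
             \<and> (\<forall>t::real. Finf (of_real t) a b = Jinf t $$ (a,b))
             \<and> (\<forall>z. \<bar>Im z\<bar> < \<rho> \<longrightarrow> cmod (Finf z a b) \<le> K))"
    and TS_inv: "\<forall>N\<ge>1. invertible_mat (L_TS n \<omega>0 \<omega>f (J N) (2*N+1))"
    and TS_bdd: "\<exists>K. \<forall>N\<ge>1. opnorm2 (mat_inv (L_TS n \<omega>0 \<omega>f (J N) (2*N+1))) \<le> K"
  shows "\<exists>\<sigma>inf. (\<lambda>N. sigma_HR n m B \<omega>0 \<omega>f (J N) N) \<longlonglongrightarrow> \<sigma>inf
           \<and> (\<exists>C' \<alpha>'. C' > 0 \<and> \<alpha>' > 0 \<and> (\<forall>N\<ge>1.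
                \<bar>sigma_TS n m B \<omega>0 \<omega>f (J N) (2*N+1) - \<sigma>inf\<bar> \<le> C' * exp (- \<alpha>' * real (2*N+1))))"
proof -
  define V where "V = opnorm2 B"
  define A where "A = 2 * M * V"
  obtain K0 where K0: "\<And>N. N \<ge> 1 \<Longrightarrow> opnorm2 (mat_inv (L_TS n \<omega>0 \<omega>f (J N) (2*N+1))) \<le> K0"
    using TS_bdd by blast
  \<comment> \<open>The given bound need not be positive; the maximum with 1 makes it so.\<close>
  define K where "K = max K0 1"
  define e where "e = 1 - exp (- (\<alpha> / 2))"
  \<comment> \<open>The second entry solves the smallness condition of the decay estimate, 8 n C M
    (4b/\<alpha>) \<le> e, for b. The cap \<alpha>/4 also keeps b below \<alpha>/2, the rate of the
    Fourier tails.\<close>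
  define b where "b = min (\<alpha> / 4) (e * \<alpha> / (32 * real n * C * M))"
  define G where "G = 2 * C / (1 - exp (- \<alpha> / 2))"
  define c where "c N d i j = fourier_coeff n \<omega>0 (J N) d $$ (i,j)" for N d i j
  have cN: "c N = (\<lambda>d i j. fourier_coeff n \<omega>0 (J N) d $$ (i,j))" for N by (simp add: c_def fun_eq_iff)
  define \<sigma> where "\<sigma> N = sigma_HR n m B \<omega>0 \<omega>f (J N) N" for N
  have V: "V \<ge> 0" unfolding V_def by (rule opnorm2_nonneg[OF B_dim])
  have A: "A \<ge> 0" using V consts_pos by (simp add: A_def)
  have e: "e > 0" using consts_pos by (simp add: e_def)
  have G: "G \<ge> 0" using consts_pos by (simp add: G_def)
  have b: "b > 0" "b \<le> \<alpha> / 4" using e consts_pos n_pos by (auto simp: b_def)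
  have "b \<le> e * \<alpha> / (32 * real n * C * M)" by (simp add: b_def)
  hence b3: "8 * real n * C * M * (4 * b / \<alpha>) \<le> 1 - exp (- (\<alpha> / 2))"
    using consts_pos n_pos by (simp add: e_def[symmetric] field_simps)
  have fc: "fourier_coeff n \<omega>0 (J N) d \<in> carrier_mat n n" for N d by (simp add: fourier_coeff_def)
  have fcinf: "fourier_coeff n \<omega>0 Jinf d \<in> carrier_mat n n" for d by (simp add: fourier_coeff_def)
  have c: "cmod (c N d i j) \<le> C * exp (- \<alpha> * \<bar>real_of_int d\<bar>)" if "N \<ge> 1" "i < n" "j < n" for N d i j
    unfolding c_def using cmod_index_le_opnorm2[OF fc that(2,3)] J1 that(1) by (meson order_trans)
  have cinf: "cmod (c N d i j - fourier_coeff n \<omega>0 Jinf d $$ (i,j)) \<le> C * exp (- \<alpha> * real N)"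
    if N: "N \<ge> 1" and ij: "i < n" "j < n" and d: "\<bar>d\<bar> \<le> int N" for N d i j
  proof -
    have "c N d i j - fourier_coeff n \<omega>0 Jinf d $$ (i,j) = (fourier_coeff n \<omega>0 (J N) d - fourier_coeff n \<omega>0 Jinf d) $$ (i,j)"
      using ij fc fcinf by (simp add: c_def fourier_coeff_def)
    also have "cmod \<dots> \<le> opnorm2 (fourier_coeff n \<omega>0 (J N) d - fourier_coeff n \<omega>0 Jinf d)"
      by (rule cmod_index_le_opnorm2[OF minus_carrier_mat[OF fcinf] ij])
    finally show ?thesis using J2 N d by (meson order_trans)
  qed
  \<comment> \<open>For |d| \<le> N both levels are near the limiting coefficient by (J2); beyond
    that, (J2) is silent at level N, but both coefficients are small by (J1). Either way two
    contributions arise, hence 2C.\<close>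
  have cc: "cmod (c N d i j - c (Suc N) d i j) \<le> 2 * C * exp (- \<alpha> * real N)"
    if N: "N \<ge> 1" and ij: "i < n" "j < n" for N d i j
  proof (cases "\<bar>d\<bar> \<le> int N")
    case True
    have "C * exp (- \<alpha> * real (Suc N)) \<le> C * exp (- \<alpha> * real N)" using consts_pos by simp
    moreover have "cmod (c (Suc N) d i j - fourier_coeff n \<omega>0 Jinf d $$ (i,j)) \<le> C * exp (- \<alpha> * real (Suc N))"
      using True by (intro cinf ij) auto
    ultimately show ?thesis
      using cinf[OF N ij True] norm_triangle_ineq4[of "c N d i j - fourier_coeff n \<omega>0 Jinf d $$ (i,j)"
          "c (Suc N) d i j - fourier_coeff n \<omega>0 Jinf d $$ (i,j)"] by simp
  next
    case False
    hence "real N \<le> \<bar>real_of_int d\<bar>" by linarith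
    hence "C * exp (- \<alpha> * \<bar>real_of_int d\<bar>) \<le> C * exp (- \<alpha> * real N)" using consts_pos by simp
    thus ?thesis
      using c[OF N ij, of d] c[OF _ ij, of "Suc N" d] norm_triangle_ineq4[of "c N d i j" "c (Suc N) d i j"] by simp
  qed
  have L_HR: "L_HR n \<omega>0 \<omega>f (J N) N \<in> carrier_mat ((2*N+1)*n) ((2*N+1)*n)" for N by (simp add: L_HR_def)
  have B_HR: "B_HR n m B N \<in> carrier_mat ((2*N+1)*n) m" for N by (simp add: B_HR_def)
  have L_TS: "L_TS n \<omega>0 \<omega>f (J N) p \<in> carrier_mat (p*n) (p*n)" for N p
    unfolding L_TS_def J_TS_def by (intro minus_carrier_mat) simp
  have B_TS: "B_TS n m B p \<in> carrier_mat (p*n) m" for p by (simp add: B_TS_def)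
  have stab: "L2_set (\<lambda>q. cmod (y q)) (hr_index n N) \<le> M * L2_set (\<lambda>q. cmod (hr_op n \<omega>0 \<omega>f (c N) N y q)) (hr_index n N)"
    if N: "N \<ge> 1" for N y
    unfolding cN using J3_HR N
    by (intro mat_stability_reindexed[OF bij_betw_hr_index[OF n_pos] L_HR] hr_op_eq_L_HR[OF n_pos]) auto
  define Jm where "Jm N i e f = J N (ts_node \<omega>0 (2*N+1) i) $$ (e,f)" for N i e f
  have JmN: "Jm N = (\<lambda>i e f. J N (ts_node \<omega>0 (2*N+1) i) $$ (e,f))" for N by (simp add: Jm_def fun_eq_iff)
  have stabTS: "L2_set (\<lambda>q. cmod (y q)) ({..<2*N+1} \<times> {..<n})
      \<le> K * L2_set (\<lambda>q. cmod (ts_op n \<omega>0 \<omega>f (Jm N) (2*N+1) y q)) ({..<2*N+1} \<times> {..<n})"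
    if N: "N \<ge> 1" for N y
  proof -
    have "invertible_mat (L_TS n \<omega>0 \<omega>f (J N) (2*N+1))" "opnorm2 (mat_inv (L_TS n \<omega>0 \<omega>f (J N) (2*N+1))) \<le> K"
      using TS_inv K0[OF N] N by (auto simp: K_def)
    thus ?thesis unfolding JmN
      by (rule mat_stability_reindexed[OF bij_betw_div_mod[OF n_pos] L_TS _ _ ts_op_eq_L_TS[OF n_pos]])
  qed
  \<comment> \<open>The window from -N - l to N - l contains every harmonic of modulus at most N -
    |l|, so this number plays the role of R. The tail estimate halves the rate.\<close>
  have tail: "cmod (Jm N i e f - (\<Sum>k=-int N..int N. c N (k - l) e f * fexp \<omega>0 (k - l) (ts_node \<omega>0 (2*N+1) i)))
          \<le> G * exp (- (\<alpha> / 2) * (real N - \<bar>real_of_int l\<bar>))"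
    if N: "N \<ge> 1" and ef: "e < n" "f < n" and l: "\<bar>l\<bar> \<le> int N" for N i e f l
  proof -
    let ?t = "ts_node \<omega>0 (2*N+1) i"
    have cont: "continuous_on UNIV (\<lambda>t. J N t $$ (e,f))" using J_cont N ef by blast
    have "(\<Sum>k=-int N..int N. c N (k - l) e f * fexp \<omega>0 (k - l) ?t) = (\<Sum>k\<in>{-int N - l..int N - l}. c N k e f * fexp \<omega>0 k ?t)"
      by (rule sum.reindex_bij_witness[of _ "\<lambda>k. k + l" "\<lambda>k. k - l"]) auto
    moreover have "real (nat (int N - \<bar>l\<bar>)) = real N - \<bar>real_of_int l\<bar>" using l by simp
    moreover have "cmod (J N ?t $$ (e,f) - (\<Sum>k\<in>{-int N - l..int N - l}. c N k e f * fexp \<omega>0 k ?t))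
        \<le> 2 * C / (1 - exp (- \<alpha> / 2)) * exp (- (\<alpha> / 2) * real (nat (int N - \<bar>l\<bar>)))"
    proof (rule fourier_series_tail[where f = "\<lambda>t. J N t $$ (e,f)" and c = "\<lambda>k. c N k e f", OF w0_pos cont _ _ consts_pos(3)])
      show "((\<lambda>t. J N t $$ (e,f) * fexp \<omega>0 (- k) t) has_integral of_real (T0 \<omega>0) * c N k e f) {0..T0 \<omega>0}" for k
        unfolding c_def by (rule fourier_coeff_has_integral[where Jf = "J N", OF w0_pos ef cont])
      show "real (nat (int N - \<bar>l\<bar>)) \<le> \<bar>real_of_int k\<bar>" if "k \<notin> {- int N - l..int N - l}" for k
        using that by auto
    qed (use J_per N c[OF N ef] in auto)
    ultimately show ?thesis by (simp add: Jm_def G_def)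
  qed
  have solHR: "\<exists>x. (\<forall>q\<in>hr_index n N. hr_op n \<omega>0 \<omega>f (c N) N x q = hr_rhs (\<lambda>a. (B *\<^sub>v u) $ a) q)
      \<and> L2_set (\<lambda>q. cmod (x q)) (hr_index n N) = vnorm2 ((mat_inv (L_HR n \<omega>0 \<omega>f (J N) N) * B_HR n m B N) *\<^sub>v u)"
    if N: "N \<ge> 1" and u: "u \<in> carrier_vec m" for N u
  proof -
    have inv: "invertible_mat (L_HR n \<omega>0 \<omega>f (J N) N)" using J3_HR N by blast
    show ?thesis
      by (rule mat_solution_reindexed[OF bij_betw_hr_index[OF n_pos] L_HR inv B_HR u
            hr_op_eq_L_HR[OF n_pos] hr_rhs_eq_B_HR[OF n_pos B_dim u]]) (unfold cN, blast+)
  qed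
  have solTS: "\<exists>y. (\<forall>q\<in>{..<2*N+1} \<times> {..<n}. ts_op n \<omega>0 \<omega>f (Jm N) (2*N+1) y q = of_real (1 / sqrt (real (2*N+1))) * (B *\<^sub>v u) $ snd q)
      \<and> L2_set (\<lambda>q. cmod (y q)) ({..<2*N+1} \<times> {..<n})
        = vnorm2 ((mat_inv (L_TS n \<omega>0 \<omega>f (J N) (2*N+1)) * B_TS n m B (2*N+1)) *\<^sub>v u)"
    if N: "N \<ge> 1" and u: "u \<in> carrier_vec m" for N u
  proof -
    have inv: "invertible_mat (L_TS n \<omega>0 \<omega>f (J N) (2*N+1))" using TS_inv N by blast
    have rhs: "of_real (1 / sqrt (real (2*N+1))) * (B *\<^sub>v u) $ snd (r div n, r mod n) = (B_TS n m B (2*N+1) *\<^sub>v u) $ r"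
      if "r < (2*N+1)*n" for r
      using ts_rhs_eq_B_TS[OF n_pos B_dim u that] by simp
    show ?thesis
      by (rule mat_solution_reindexed[OF bij_betw_div_mod[OF n_pos] L_TS inv B_TS u
            ts_op_eq_L_TS[OF n_pos], where rhs = "\<lambda>q. of_real (1 / sqrt (real (2*N+1))) * (B *\<^sub>v u) $ snd q"])
        (use rhs in \<open>unfold JmN, blast+\<close>)
  qed
  have decay: "cmod (x q) \<le> A * exp (- b * \<bar>real_of_int (fst q)\<bar>)"
    if N: "N \<ge> 1" and u: "u \<in> carrier_vec m" "vnorm2 u \<le> 1"
      and x: "\<forall>q\<in>hr_index n N. hr_op n \<omega>0 \<omega>f (c N) N x q = hr_rhs (\<lambda>a. (B *\<^sub>v u) $ a) q"
      and q: "q \<in> hr_index n N" for N u x q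
    unfolding A_def
    by (rule hr_solution_decay[OF consts_pos(3,1,2) b b3 c[OF N] stab[OF N] _ _ q])
      (use x L2_set_hr_rhs_le[OF B_dim u] in \<open>auto simp: V_def\<close>)
  have inv_dim: "mat_inv (L_HR n \<omega>0 \<omega>f (J N) N) * B_HR n m B N \<in> carrier_mat ((2*N+1)*n) m"
      "mat_inv (L_TS n \<omega>0 \<omega>f (J N) (2*N+1)) * B_TS n m B (2*N+1) \<in> carrier_mat ((2*N+1)*n) m" if N: "N \<ge> 1" for N
    using mat_inv_inverse(1)[OF L_HR] mat_inv_inverse(1)[OF L_TS] J3_HR TS_inv N B_HR B_TS
    by (meson mult_carrier_mat)+
  \<comment> \<open>In \<open>poly\<close> below, s = 3 serves the step from N to N + 1, whose
    larger index set has (2N + 3) n elements, and s = 1 serves collocation. Both counts are at most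
    (2N + 3) n.\<close>
  define P where "P = (real n)\<^sup>2 * (3 + 8 / b)\<^sup>2"
  have poly: "real ((2 * N + s) * n) * (real ((2 * N + 1) * n) * (F * exp (- b * real N))) \<le> F * P * exp (- (b / 2) * real N)"
    if "F \<ge> 0" "s \<le> 3" for N s and F :: real
  proof -
    have "real ((2 * N + s) * n) * (real ((2 * N + 1) * n) * (F * exp (- b * real N)))
        = F * (real n)\<^sup>2 * ((real (2 * N + s) * real (2 * N + 1)) * exp (- b * real N))"
      by (simp only: of_nat_mult power2_eq_square mult_ac)
    also have "\<dots> \<le> F * (real n)\<^sup>2 * ((2 * real N + 3)\<^sup>2 * exp (- b * real N))"
      unfolding power2_eq_square[of "2 * real N + 3"] using that
      by (intro mult_left_mono mult_right_mono mult_mono) auto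
    also have "\<dots> \<le> F * (real n)\<^sup>2 * ((3 + 8 / b)\<^sup>2 * exp (- (b / 2) * real N))"
      using that square_mult_exp_le[OF b(1)] by (intro mult_left_mono) auto
    finally show ?thesis by (simp add: P_def mult_ac)
  qed
  have step: "\<bar>\<sigma> (Suc N) - \<sigma> N\<bar> \<le> M * (2 * C * A * P) * exp (- (b / 2) * real N)" if N: "N \<ge> 1" for N
    unfolding \<sigma>_def sigma_HR_def
  proof (rule sigma_max_diff_le[OF inv_dim(1) inv_dim(1)[OF N] m_pos])
    fix u :: "complex vec" assume u: "u \<in> carrier_vec m" "vnorm2 u \<le> 1"
    obtain x where x: "\<forall>q\<in>hr_index n N. hr_op n \<omega>0 \<omega>f (c N) N x q = hr_rhs (\<lambda>a. (B *\<^sub>v u) $ a) q"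
      "L2_set (\<lambda>q. cmod (x q)) (hr_index n N) = vnorm2 ((mat_inv (L_HR n \<omega>0 \<omega>f (J N) N) * B_HR n m B N) *\<^sub>v u)"
      using solHR[OF N u(1)] by blast
    have N': "Suc N \<ge> 1" by simp
    obtain x' where x': "\<forall>q\<in>hr_index n (Suc N). hr_op n \<omega>0 \<omega>f (c (Suc N)) (Suc N) x' q = hr_rhs (\<lambda>a. (B *\<^sub>v u) $ a) q"
      "L2_set (\<lambda>q. cmod (x' q)) (hr_index n (Suc N)) = vnorm2 ((mat_inv (L_HR n \<omega>0 \<omega>f (J (Suc N)) (Suc N)) * B_HR n m B (Suc N)) *\<^sub>v u)"
      using solHR[OF N' u(1)] by blast
    have "\<bar>L2_set (\<lambda>q. cmod (x' q)) (hr_index n (Suc N)) - L2_set (\<lambda>q. cmod (x q)) (hr_index n N)\<bar>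
        \<le> M * (real ((2 * N + 3) * n) * (real ((2 * N + 1) * n) * (2 * C * A * exp (- b * real N))))"
      by (rule hr_step_close[OF consts_pos(1,2) b(1) _ A c[OF N'] cc[OF N] stab[OF N'] _ _ decay[OF N u x(1)]])
        (use b consts_pos x(1) x'(1) in auto)
    also have "\<dots> \<le> M * (2 * C * A * P * exp (- (b / 2) * real N))"
      using consts_pos A by (intro mult_left_mono poly) auto
    finally show "\<bar>vnorm2 ((mat_inv (L_HR n \<omega>0 \<omega>f (J (Suc N)) (Suc N)) * B_HR n m B (Suc N)) *\<^sub>v u)
        - vnorm2 ((mat_inv (L_HR n \<omega>0 \<omega>f (J N) N) * B_HR n m B N) *\<^sub>v u)\<bar> \<le> M * (2 * C * A * P) * exp (- (b / 2) * real N)"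
      by (simp add: x x' mult_ac)
  qed simp
  have ts: "\<bar>sigma_TS n m B \<omega>0 \<omega>f (J N) (2*N+1) - \<sigma> N\<bar> \<le> K * (G * A * P) * exp (- (b / 2) * real N)" if N: "N \<ge> 1" for N
    unfolding \<sigma>_def sigma_HR_def sigma_TS_def
  proof (rule sigma_max_diff_le[OF inv_dim(2,1)[OF N] m_pos])
    fix u :: "complex vec" assume u: "u \<in> carrier_vec m" "vnorm2 u \<le> 1"
    obtain x where x: "\<forall>q\<in>hr_index n N. hr_op n \<omega>0 \<omega>f (c N) N x q = hr_rhs (\<lambda>a. (B *\<^sub>v u) $ a) q"
      "L2_set (\<lambda>q. cmod (x q)) (hr_index n N) = vnorm2 ((mat_inv (L_HR n \<omega>0 \<omega>f (J N) N) * B_HR n m B N) *\<^sub>v u)"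
      using solHR[OF N u(1)] by blast
    obtain y where y: "\<forall>q\<in>{..<2*N+1} \<times> {..<n}. ts_op n \<omega>0 \<omega>f (Jm N) (2*N+1) y q = of_real (1 / sqrt (real (2*N+1))) * (B *\<^sub>v u) $ snd q"
      "L2_set (\<lambda>q. cmod (y q)) ({..<2*N+1} \<times> {..<n})
        = vnorm2 ((mat_inv (L_TS n \<omega>0 \<omega>f (J N) (2*N+1)) * B_TS n m B (2*N+1)) *\<^sub>v u)"
      using solTS[OF N u(1)] by blast
    have K: "K > 0" by (simp add: K_def)
    have "\<bar>L2_set (\<lambda>q. cmod (y q)) ({..<2*N+1} \<times> {..<n}) - L2_set (\<lambda>q. cmod (x q)) (hr_index n N)\<bar>
        \<le> K * (real ((2 * N + 1) * n) * (real ((2 * N + 1) * n) * (G * A * exp (- b * real N))))"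
      by (rule hr_ts_close[where a = "\<alpha> / 2" and v = "\<lambda>a. (B *\<^sub>v u) $ a" and c = "c N" and Jm = "Jm N" and w = \<omega>0 and \<omega>f = \<omega>f,
            OF w0_pos refl K b(1) _ A G stabTS[OF N] _ _ decay[OF N u x(1)] tail[OF N]])
        (use b x(1) y(1) consts_pos in auto)
    also have "\<dots> \<le> K * (G * A * P * exp (- (b / 2) * real N))"
      using K G A by (intro mult_left_mono poly) auto
    finally show "\<bar>vnorm2 ((mat_inv (L_TS n \<omega>0 \<omega>f (J N) (2*N+1)) * B_TS n m B (2*N+1)) *\<^sub>v u)
        - vnorm2 ((mat_inv (L_HR n \<omega>0 \<omega>f (J N) N) * B_HR n m B N) *\<^sub>v u)\<bar> \<le> K * (G * A * P) * exp (- (b / 2) * real N)"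
      by (simp only: x y mult.assoc)
  qed
  \<comment> \<open>The first summand measures level N against the limit, as a geometric sum of
    steps; the second measures collocation against level N.\<close>
  define Q where "Q = M * (2 * C * A * P) / (1 - exp (- (b / 2))) + K * (G * A * P)"
  have b2: "b / 2 > 0" using b by simp
  obtain L where L: "\<sigma> \<longlonglongrightarrow> L"
    "\<And>N. N \<ge> 1 \<Longrightarrow> \<bar>\<sigma> N - L\<bar> \<le> M * (2 * C * A * P) / (1 - exp (- (b / 2))) * exp (- (b / 2) * real N)"
    using limit_of_exp_small_steps[OF b2 step] by blast
  have Q: "Q \<ge> 0" using consts_pos A G b by (simp add: Q_def P_def K_def)
  \<comment> \<open>Since bN/2 = (b/4)(2N + 1) - b/4, the rate per node is b/4, and exp(b/4) joins
    the constant. Q + 1 keeps that constant positive when Q = 0, as happens for B = 0.\<close>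
  have "\<bar>sigma_TS n m B \<omega>0 \<omega>f (J N) (2*N+1) - L\<bar> \<le> ((Q + 1) * exp (b / 4)) * exp (- (b / 4) * real (2*N+1))"
    if N: "N \<ge> 1" for N
  proof -
    have "\<bar>sigma_TS n m B \<omega>0 \<omega>f (J N) (2*N+1) - L\<bar>
        \<le> \<bar>sigma_TS n m B \<omega>0 \<omega>f (J N) (2*N+1) - \<sigma> N\<bar> + \<bar>\<sigma> N - L\<bar>" by linarith
    also have "\<dots> \<le> Q * exp (- (b / 2) * real N)"
      using add_mono[OF ts[OF N] L(2)[OF N]] by (simp add: Q_def distrib_right)
    also have "\<dots> \<le> (Q + 1) * exp (- (b / 2) * real N)" by (intro mult_right_mono) auto
    also have "exp (- (b / 2) * real N) = exp (b / 4) * exp (- (b / 4) * real (2*N+1))"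
      unfolding exp_add[symmetric] by (simp add: field_simps)
    finally show ?thesis by (simp only: mult.assoc)
  qed
  moreover have "(Q + 1) * exp (b / 4) > 0" "b / 4 > 0" using Q b by auto
  ultimately show ?thesis using L(1) unfolding \<sigma>_def by blast
qed

end
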